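(* Consider an interacting particle system on $\Omega=X^{\mathbb Z^d}$ given by local operators $(L_{x,y})_{x,y\in\mathbb Z^d}$, a measure $\mu$ and a conserved quantity $\xi$ as described in the context (including the standing assumptions that the Green–Kubo formula and the variational formula for the diffusion matrix $D$ hold). Assume that $\mu$ is product with single-site marginal $\nu$, i.e. $\mu=\nu^{\mathbb Z^d}$, and that $L^2(\nu)$ is separable. Then the system satisfies the gradient condition (i.e. $j_\alpha\in\mathfrak G$ for all $\alpha=1,\dots,d$) if and only if $D=D^s$. Moreover, if the interaction is nearest-neighbour (i.e. $L_{0,z}\equiv 0$ unless $z\in\{\pm e_1,\dots,\pm e_d\}$), then $D=D^s$ if and only if $j_{0,e_\alpha}\in\mathfrak G$ for all $\alpha=1,\dots,d$.
   Context: **Space.** $X$ is a measurable space, $\Omega=X^{\mathbb Z^d}$ with the product $\sigma$-algebra, and $\mu$ is a translation invariant probability measure on $\Omega$; $\langle\cdot\rangle$ is expectation under $\mu$ and $\langle\cdot,\cdot\rangle$ the inner product of (real) $L^2(\mu)$. Shifts: $(\tau_z\eta)_x=\eta_{x+z}$, $(\tau_zf)(\eta)=f(\tau_z\eta)$; $\tau^\alpha=\tau_{e_\alpha}$, with $e_\alpha$ the $\alpha$-th unit vector. $|x|=\max_\alpha|x_\alpha|$. A function is local if it depends on finitely many coordinates; for local $f$, $s_f:=\min\{n\ge0: f\text{ does not depend on }(\eta_x)_{|x|\ge n+1}\}$. $\mathcal D:=\{f\in L^2(\mu): f\text{ local}\}$. An operator $T:\mathcal D\to\mathcal D$ is local if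 there is $r\ge 0$ with $s_{Tf}\le\max\{s_f,r\}$ for all $f$. **Dynamics.** $(L_{x,y})_{x,y\in\mathbb Z^d}$ are local (linear) operators with $L_{x,x}\equiv0$, $L_{x,y}\mathbf 1=0$, and: translation invariance $L_{x,y}=\tau_xL_{0,y-x}\tau_{-x}$; finite range: there is $R>0$ with $L_{0,z}\equiv0$ for $|z|>R$; symmetry $L_{0,z}=L_{z,0}$; reversibility $\langle L_{0,x}f,g\rangle=\langle f,L_{0,x}g\rangle$ for $f,g\in\mathcal D$; non-positivity $\mathcal D_{0,x}(f):=\langle -L_{0,x}f,f\rangle\ge0$ for $f\in\mathcal D$. It is assumed that $L=\sum_{x,y}L_{x,y}$ is the (formal) generator of a Markov process $\{\eta_x(t)\}_{x\in\mathbb Z^d}$ started from its stationary measure $\mu$, with semigroup $e^{tL}$. **Conserved quantity.** $\xi:X\to\mathbb R$ is measurable, $\xi_x:=\xi(\eta_x)$, $\xi_0\in L^2(\mu)$, $L_{x,y}(\xi_x+\xi_y)=0$ and $L_{x,y}\xi_z=0$ for $z\ne x,y$. Currents: $j_{0,x}:=2L_{0,x}\xi_0$ and $j_\alpha:=\sum_{x\in\mathbb Z^d}x_\alpha j_{0,x}$. **Diffusion matrix.** With $\rho=\langle\xi_0\rangle$, $\xi_x(t)=\xi(\eta_x(t))$, $S(x,t):=\mathbb E[\xi_x(t)\xi_0(0)]-\rho^2$, $\chi:=\sum_xS(x,t)$ (assumed finite and positive), put $$D_{\alpha\beta}:=\lim_{t\to\infty}\frac1t\frac1{2\chi}\sum_{x}x_\alpha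 x_\beta S(x,t),\qquad D^s_{\alpha\beta}:=\frac1\chi\sum_xx_\alpha x_\beta\,\mathcal D_{0,x}(\xi_0).$$ **Hilbert space.** For $f,g\in\mathcal D$, $\langle f|g\rangle:=\sum_{x}(\langle(\tau_xf)g\rangle-\langle f\rangle\langle g\rangle)$ (assumed well defined; automatic for product $\mu$). $\mathcal H$ is the completion of $\mathcal D$ with respect to this degenerate scalar product (after quotienting by its null space). It is assumed that $e^{tL}$ induces a self-adjoint semigroup $T_t$ on $\mathcal H$ with generator $\tilde L$, that $\mathcal D$ lies in the domain of $\tilde L$, and that $-\langle f|\tilde Lf\rangle\ge0$ for $f\in\mathcal D$. **Standing assumptions on $D$.** The Green–Kubo formula holds: $$D_{\alpha\beta}=D^s_{\alpha\beta}-\frac1{4\chi}\int_0^\infty\sum_x\mathbb E[j_\alpha e^{tL}\tau_xj_\beta]\,dt,$$ and for all $\ell\in\mathbb R^d$ the variational formula holds: $$\sum_{\alpha,\beta}\ell_\alpha\ell_\beta D_{\alpha\beta}=\sum_{\alpha,\beta}\ell_\alpha\ell_\beta D^s_{\alpha\beta}+\frac1\chi\inf_{f\in\mathcal D}\Big\{-\Big\langle\sum_\alpha\ell_\alpha j_\alpha\Big|f\Big\rangle-\langle f|\tilde Lf\rangle\Big\}.$$ **Gradient condition.** $\mathfrak G:=\{\sum_{\alpha=1}^d(\tau^\alpha g_\alpha-g_\alpha): g_\alpha\in\mathcal D\}$; the system satisfies the gradient condition if $j_\alpha\in\mathfrak G$ for all $\alpha=1,\dots,d$. *)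

theory Defs
  imports "HOL-Probability.Probability"
begin

text \<open>
  Throughout, \<open>\<int>\<^sup>d\<close> is the type \<open>int ^ 'd\<close> with \<open>'d\<close> an arbitrary finite index type, and a
  configuration space \<open>X\<^bsup>\<int>\<^sup>d\<^esup>\<close> is the space of a product measure on \<open>int ^ 'd \<Rightarrow> 'a\<close>.  Elements of
  \<open>L\<^sup>2(\<mu>)\<close> are represented by functions; every identity between elements of \<open>L\<^sup>2(\<mu>)\<close>, and every
  notion applied to them, is accordingly taken up to \<open>\<mu>\<close>-almost everywhere equality.
\<close>

type_synonym ('a, 'd) config = "int ^ 'd \<Rightarrow> 'a"
type_synonym ('a, 'd) obs = "('a, 'd) config \<Rightarrow> real"

abbreviation ae_eq :: "'b measure \<Rightarrow> ('b \<Rightarrow> real) \<Rightarrow> ('b \<Rightarrow> real) \<Rightarrow> bool" where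
  "ae_eq M f g \<equiv> (AE x in M. f x = g x)"

section \<open>Square-integrable functions\<close>

definition L2 :: "'b measure \<Rightarrow> ('b \<Rightarrow> real) set" where
  "L2 M = {f \<in> borel_measurable M. integrable M (\<lambda>x. (f x)\<^sup>2)}"

definition L2_tendsto :: "'b measure \<Rightarrow> 'i filter \<Rightarrow> ('i \<Rightarrow> 'b \<Rightarrow> real) \<Rightarrow> ('b \<Rightarrow> real) \<Rightarrow> bool" where
  "L2_tendsto M F u f \<longleftrightarrow> f \<in> L2 M \<and> (\<forall>\<^sub>F i in F. u i \<in> L2 M) \<and>
     ((\<lambda>i. \<integral>x. (u i x - f x)\<^sup>2 \<partial>M) \<longlongrightarrow> 0) F"

definition L2_separable :: "'b measure \<Rightarrow> bool" where
  "L2_separable M \<longleftrightarrow> (\<exists>C. countable C \<and> C \<subseteq> L2 M \<and>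
     (\<forall>f\<in>L2 M. \<forall>e>0. \<exists>g\<in>C. sqrt (\<integral>x. (f x - g x)\<^sup>2 \<partial>M) < e))"

section \<open>Shifts and local functions\<close>

definition max_norm :: "int ^ 'd::finite \<Rightarrow> int" where
  "max_norm x = Max (range (\<lambda>\<alpha>. \<bar>x $ \<alpha>\<bar>))"

definition unit_vec :: "'d::finite \<Rightarrow> int ^ 'd" where
  "unit_vec \<alpha> = axis \<alpha> 1"

definition shift :: "int ^ 'd::finite \<Rightarrow> ('a, 'd) config \<Rightarrow> ('a, 'd) config" where
  "shift z \<eta> = (\<lambda>x. \<eta> (x + z))"

definition translate :: "int ^ 'd::finite \<Rightarrow> ('a, 'd) obs \<Rightarrow> ('a, 'd) obs" where
  "translate z f = (\<lambda>\<eta>. f (shift z \<eta>))"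

definition depends_on ::
  "('a, 'd::finite) config measure \<Rightarrow> (int ^ 'd) set \<Rightarrow> ('a, 'd) obs \<Rightarrow> bool" where
  "depends_on \<mu> \<Lambda> f \<longleftrightarrow> (\<exists>g\<in>borel_measurable \<mu>. ae_eq \<mu> f g \<and>
     (\<forall>\<eta>\<in>space \<mu>. \<forall>\<zeta>\<in>space \<mu>. (\<forall>x\<in>\<Lambda>. \<eta> x = \<zeta> x) \<longrightarrow> g \<eta> = g \<zeta>))"

definition local_fun :: "('a, 'd::finite) config measure \<Rightarrow> ('a, 'd) obs \<Rightarrow> bool" where
  "local_fun \<mu> f \<longleftrightarrow> (\<exists>\<Lambda>. finite \<Lambda> \<and> depends_on \<mu> \<Lambda> f)"

definition fun_range :: "('a, 'd::finite) config measure \<Rightarrow> ('a, 'd) obs \<Rightarrow> nat" where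
  "fun_range \<mu> f = (LEAST n. depends_on \<mu> {x. max_norm x \<le> int n} f)"

text \<open>The space \<open>\<D>\<close> of local functions in \<open>L\<^sup>2(\<mu>)\<close>.\<close>

definition local_L2 :: "('a, 'd::finite) config measure \<Rightarrow> ('a, 'd) obs set" where
  "local_L2 \<mu> = {f \<in> L2 \<mu>. local_fun \<mu> f}"

text \<open>Linear operators \<open>T : \<D> \<rightarrow> \<D>\<close> that are local; the second condition says that
  \<open>T\<close> is well defined on almost-everywhere classes.\<close>

definition local_operator ::
  "('a, 'd::finite) config measure \<Rightarrow> (('a, 'd) obs \<Rightarrow> ('a, 'd) obs) \<Rightarrow> bool" where
  "local_operator \<mu> T \<longleftrightarrow>
     (\<forall>f\<in>local_L2 \<mu>. T f \<in> local_L2 \<mu>) \<and>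
     (\<forall>f\<in>local_L2 \<mu>. \<forall>g\<in>local_L2 \<mu>. ae_eq \<mu> f g \<longrightarrow> ae_eq \<mu> (T f) (T g)) \<and>
     (\<forall>f\<in>local_L2 \<mu>. \<forall>g\<in>local_L2 \<mu>. \<forall>a b.
        ae_eq \<mu> (T (\<lambda>\<eta>. a * f \<eta> + b * g \<eta>)) (\<lambda>\<eta>. a * T f \<eta> + b * T g \<eta>)) \<and>
     (\<exists>r. \<forall>f\<in>local_L2 \<mu>. fun_range \<mu> (T f) \<le> max (fun_range \<mu> f) r)"

definition gradient_space :: "('a, 'd::finite) config measure \<Rightarrow> ('a, 'd) obs set" where
  "gradient_space \<mu> = {f. \<exists>g :: 'd \<Rightarrow> ('a, 'd) obs. (\<forall>\<alpha>. g \<alpha> \<in> local_L2 \<mu>) \<and>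
     ae_eq \<mu> f (\<lambda>\<eta>. \<Sum>\<alpha>\<in>UNIV. translate (unit_vec \<alpha>) (g \<alpha>) \<eta> - g \<alpha> \<eta>)}"

section \<open>Interaction, conserved quantity and currents\<close>

type_synonym ('a, 'd) interaction =
  "int ^ 'd \<Rightarrow> int ^ 'd \<Rightarrow> ('a, 'd) obs \<Rightarrow> ('a, 'd) obs"

definition site_obs :: "('a \<Rightarrow> real) \<Rightarrow> int ^ 'd::finite \<Rightarrow> ('a, 'd) obs" where
  "site_obs \<xi> x = (\<lambda>\<eta>. \<xi> (\<eta> x))"

definition dirichlet :: "('a, 'd::finite) config measure \<Rightarrow> ('a, 'd) interaction \<Rightarrow>
    int ^ 'd \<Rightarrow> ('a, 'd) obs \<Rightarrow> real" where
  "dirichlet \<mu> L x f = (\<integral>\<eta>. - L 0 x f \<eta> * f \<eta> \<partial>\<mu>)"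

definition bond_current :: "('a, 'd::finite) interaction \<Rightarrow> ('a \<Rightarrow> real) \<Rightarrow>
    int ^ 'd \<Rightarrow> ('a, 'd) obs" where
  "bond_current L \<xi> x = (\<lambda>\<eta>. 2 * L 0 x (site_obs \<xi> 0) \<eta>)"

text \<open>The sum over \<open>\<int>\<^sup>d\<close> in \<open>j\<^sub>\<alpha>\<close> is written over the sites at which \<open>j\<^sub>0\<^sub>,\<^sub>x\<close> is nonzero as an
  element of \<open>L\<^sup>2(\<mu>)\<close>; for a finite range interaction these are finitely many.\<close>

definition current :: "('a, 'd::finite) config measure \<Rightarrow> ('a, 'd) interaction \<Rightarrow>
    ('a \<Rightarrow> real) \<Rightarrow> 'd \<Rightarrow> ('a, 'd) obs" where
  "current \<mu> L \<xi> \<alpha> = (\<lambda>\<eta>. \<Sum>x | \<not> ae_eq \<mu> (bond_current L \<xi> x) (\<lambda>_. 0).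
     of_int (x $ \<alpha>) * bond_current L \<xi> x \<eta>)"

definition gradient_condition ::
  "('a, 'd::finite) config measure \<Rightarrow> ('a, 'd) interaction \<Rightarrow> ('a \<Rightarrow> real) \<Rightarrow> bool" where
  "gradient_condition \<mu> L \<xi> \<longleftrightarrow> (\<forall>\<alpha>. current \<mu> L \<xi> \<alpha> \<in> gradient_space \<mu>)"

definition nearest_neighbour ::
  "('a, 'd::finite) config measure \<Rightarrow> ('a, 'd) interaction \<Rightarrow> bool" where
  "nearest_neighbour \<mu> L \<longleftrightarrow>
     (\<forall>z. z \<notin> (\<Union>\<alpha>. {unit_vec \<alpha>, - unit_vec \<alpha>}) \<longrightarrow>
        (\<forall>f\<in>local_L2 \<mu>. ae_eq \<mu> (L 0 z f) (\<lambda>_. 0)))"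

locale interacting_system =
  fixes X :: "'a measure"
    and \<mu> :: "('a, 'd::finite) config measure"
    and L :: "('a, 'd) interaction"
    and \<xi> :: "'a \<Rightarrow> real"
  assumes prob_mu: "prob_space \<mu>"
    and sets_mu: "sets \<mu> = sets (Pi\<^sub>M UNIV (\<lambda>_. X))"
    and translation_invariant_mu: "distr \<mu> \<mu> (shift z) = \<mu>"
    and local_L: "local_operator \<mu> (L x y)"
    and L_diag: "f \<in> local_L2 \<mu> \<Longrightarrow> ae_eq \<mu> (L x x f) (\<lambda>_. 0)"
    and L_one: "ae_eq \<mu> (L x y (\<lambda>_. 1)) (\<lambda>_. 0)"
    and translation_invariant_L: "f \<in> local_L2 \<mu> \<Longrightarrow>
      ae_eq \<mu> (L x y f) (translate x (L 0 (y - x) (translate (- x) f)))"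
    and finite_range: "\<exists>R>0. \<forall>z. max_norm z > R \<longrightarrow>
      (\<forall>f\<in>local_L2 \<mu>. ae_eq \<mu> (L 0 z f) (\<lambda>_. 0))"
    and L_sym: "f \<in> local_L2 \<mu> \<Longrightarrow> ae_eq \<mu> (L 0 z f) (L z 0 f)"
    and reversible: "f \<in> local_L2 \<mu> \<Longrightarrow> g \<in> local_L2 \<mu> \<Longrightarrow>
      (\<integral>\<eta>. L 0 x f \<eta> * g \<eta> \<partial>\<mu>) = (\<integral>\<eta>. f \<eta> * L 0 x g \<eta> \<partial>\<mu>)"
    and dirichlet_nonneg: "f \<in> local_L2 \<mu> \<Longrightarrow> dirichlet \<mu> L x f \<ge> 0"
    and xi_measurable: "\<xi> \<in> borel_measurable X"
    and xi_L2: "site_obs \<xi> 0 \<in> L2 \<mu>"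
    and conserved_bond:
      "ae_eq \<mu> (L x y (\<lambda>\<eta>. site_obs \<xi> x \<eta> + site_obs \<xi> y \<eta>)) (\<lambda>_. 0)"
    and conserved_off: "z \<noteq> x \<Longrightarrow> z \<noteq> y \<Longrightarrow> ae_eq \<mu> (L x y (site_obs \<xi> z)) (\<lambda>_. 0)"

section \<open>The stationary Markov process\<close>

definition history ::
  "'w measure \<Rightarrow> 'b measure \<Rightarrow> (real \<Rightarrow> 'w \<Rightarrow> 'b) \<Rightarrow> real \<Rightarrow> 'w measure" where
  "history W M Y s =
     sigma (space W) {Y u -` A \<inter> space W | u A. 0 \<le> u \<and> u \<le> s \<and> A \<in> sets M}"

text \<open>
  \<open>P t\<close> plays the role of \<open>e\<^bsup>tL\<^esup>\<close>.  By the Markov property and stationarity, \<open>P t f\<close> is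
  determined up to null sets, so linearity, the contraction property and the semigroup law on
  \<open>L\<^sup>2(\<mu>)\<close> need not be assumed.  The last assumption says that \<open>\<Sum>\<^sub>x\<^sub>,\<^sub>y L\<^sub>x\<^sub>,\<^sub>y f\<close> converges
  unconditionally in \<open>L\<^sup>2(\<mu>)\<close> for local \<open>f\<close>, and is the derivative of \<open>P t f\<close> at \<open>t = 0\<close>.
\<close>

locale markov_system = interacting_system X \<mu> L \<xi>
  for X :: "'a measure" and \<mu> :: "('a, 'd::finite) config measure"
    and L :: "('a, 'd) interaction" and \<xi> :: "'a \<Rightarrow> real" +
  fixes W :: "'w measure"
    and Y :: "real \<Rightarrow> 'w \<Rightarrow> ('a, 'd) config"
    and P :: "real \<Rightarrow> ('a, 'd) obs \<Rightarrow> ('a, 'd) obs"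
  assumes prob_W: "prob_space W"
    and Y_measurable: "t \<ge> 0 \<Longrightarrow> Y t \<in> measurable W \<mu>"
    and stationary: "t \<ge> 0 \<Longrightarrow> distr W \<mu> (Y t) = \<mu>"
    and P_L2: "t \<ge> 0 \<Longrightarrow> f \<in> L2 \<mu> \<Longrightarrow> P t f \<in> L2 \<mu>"
    and markov: "s \<ge> 0 \<Longrightarrow> t \<ge> 0 \<Longrightarrow> f \<in> L2 \<mu> \<Longrightarrow>
      AE \<omega> in W. real_cond_exp W (history W \<mu> Y s) (\<lambda>\<omega>. f (Y (s + t) \<omega>)) \<omega> = P t f (Y s \<omega>)"
    and generator: "f \<in> local_L2 \<mu> \<Longrightarrow> \<exists>Lf.
      L2_tendsto \<mu> (finite_subsets_at_top UNIV) (\<lambda>F \<eta>. \<Sum>(x, y)\<in>F. L x y f \<eta>) Lf \<and>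
      L2_tendsto \<mu> (at_right 0) (\<lambda>t \<eta>. (P t f \<eta> - f \<eta>) / t) Lf"

section \<open>The diffusion matrix\<close>

definition two_point :: "('a, 'd::finite) config measure \<Rightarrow> ('a \<Rightarrow> real) \<Rightarrow> 'w measure \<Rightarrow>
    (real \<Rightarrow> 'w \<Rightarrow> ('a, 'd) config) \<Rightarrow> int ^ 'd \<Rightarrow> real \<Rightarrow> real" where
  "two_point \<mu> \<xi> W Y x t =
     (\<integral>\<omega>. site_obs \<xi> x (Y t \<omega>) * site_obs \<xi> 0 (Y 0 \<omega>) \<partial>W) - (\<integral>\<eta>. site_obs \<xi> 0 \<eta> \<partial>\<mu>)\<^sup>2"

text \<open>The sum over \<open>x\<close> of \<open>S(x,t)\<close>, taken here at \<open>t = 0\<close>; the independence of \<open>t\<close> is part of the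
  assumptions of \<open>diffusive_system\<close> below.\<close>

definition compressibility :: "('a, 'd::finite) config measure \<Rightarrow> ('a \<Rightarrow> real) \<Rightarrow> 'w measure \<Rightarrow>
    (real \<Rightarrow> 'w \<Rightarrow> ('a, 'd) config) \<Rightarrow> real" where
  "compressibility \<mu> \<xi> W Y = (\<Sum>\<^sub>\<infinity>x. two_point \<mu> \<xi> W Y x 0)"

definition scaled_variance :: "('a, 'd::finite) config measure \<Rightarrow> ('a \<Rightarrow> real) \<Rightarrow> 'w measure \<Rightarrow>
    (real \<Rightarrow> 'w \<Rightarrow> ('a, 'd) config) \<Rightarrow> 'd \<Rightarrow> 'd \<Rightarrow> real \<Rightarrow> real" where
  "scaled_variance \<mu> \<xi> W Y \<alpha> \<beta> t = 1 / t * (1 / (2 * compressibility \<mu> \<xi> W Y)) *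
     (\<Sum>\<^sub>\<infinity>x. of_int (x $ \<alpha>) * of_int (x $ \<beta>) * two_point \<mu> \<xi> W Y x t)"

definition diffusion_matrix :: "('a, 'd::finite) config measure \<Rightarrow> ('a \<Rightarrow> real) \<Rightarrow> 'w measure \<Rightarrow>
    (real \<Rightarrow> 'w \<Rightarrow> ('a, 'd) config) \<Rightarrow> real ^ 'd ^ 'd" where
  "diffusion_matrix \<mu> \<xi> W Y = (\<chi> \<alpha> \<beta>. Lim at_top (scaled_variance \<mu> \<xi> W Y \<alpha> \<beta>))"

definition static_diffusion_matrix :: "('a, 'd::finite) config measure \<Rightarrow> ('a, 'd) interaction \<Rightarrow>
    ('a \<Rightarrow> real) \<Rightarrow> 'w measure \<Rightarrow> (real \<Rightarrow> 'w \<Rightarrow> ('a, 'd) config) \<Rightarrow> real ^ 'd ^ 'd" where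
  "static_diffusion_matrix \<mu> L \<xi> W Y = (\<chi> \<alpha> \<beta>. 1 / compressibility \<mu> \<xi> W Y *
     (\<Sum>\<^sub>\<infinity>x. of_int (x $ \<alpha>) * of_int (x $ \<beta>) * dirichlet \<mu> L x (site_obs \<xi> 0)))"

section \<open>The Hilbert space of the degenerate scalar product\<close>

definition corr_term :: "('a, 'd::finite) config measure \<Rightarrow> ('a, 'd) obs \<Rightarrow> ('a, 'd) obs \<Rightarrow>
    int ^ 'd \<Rightarrow> real" where
  "corr_term \<mu> f g x = (\<integral>\<eta>. translate x f \<eta> * g \<eta> \<partial>\<mu>) - (\<integral>\<eta>. f \<eta> \<partial>\<mu>) * (\<integral>\<eta>. g \<eta> \<partial>\<mu>)"

definition corr_form :: "('a, 'd::finite) config measure \<Rightarrow> ('a, 'd) obs \<Rightarrow> ('a, 'd) obs \<Rightarrow> real" where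
  "corr_form \<mu> f g = (\<Sum>\<^sub>\<infinity>x. corr_term \<mu> f g x)"

definition generates :: "(real \<Rightarrow> 'h \<Rightarrow> 'h::real_normed_vector) \<Rightarrow> 'h \<Rightarrow> 'h \<Rightarrow> bool" where
  "generates T u v \<longleftrightarrow> ((\<lambda>t. (T t u - u) /\<^sub>R t) \<longlongrightarrow> v) (at_right 0)"

definition generator_domain :: "(real \<Rightarrow> 'h \<Rightarrow> 'h::real_normed_vector) \<Rightarrow> 'h set" where
  "generator_domain T = {u. \<exists>v. generates T u v}"

definition generator_of :: "(real \<Rightarrow> 'h \<Rightarrow> 'h::real_normed_vector) \<Rightarrow> 'h \<Rightarrow> 'h" where
  "generator_of T u = (THE v. generates T u v)"

text \<open>
  The completion \<open>\<H>\<close> of \<open>\<D>\<close> is a Hilbert space \<open>'h\<close> together with a linear map \<open>\<iota> : \<D> \<rightarrow> \<H>\<close> that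
  has dense range and carries \<open>corr_form\<close> to the inner product; this determines it up to a
  canonical isometry, and the kernel of \<open>\<iota>\<close> is the null space of \<open>corr_form\<close>.  That
  \<open>e\<^bsup>tL\<^esup>\<close> induces \<open>T t\<close> means that the matrix elements of \<open>T t\<close> between local functions \<open>g\<close> and \<open>f\<close>
  are given by the formula for \<open>corr_form \<mu> g (P t f)\<close>, where \<open>P t f\<close> need not be local.
\<close>

locale hilbert_system = markov_system X \<mu> L \<xi> W Y P
  for X :: "'a measure" and \<mu> :: "('a, 'd::finite) config measure"
    and L :: "('a, 'd) interaction" and \<xi> :: "'a \<Rightarrow> real"
    and W :: "'w measure" and Y :: "real \<Rightarrow> 'w \<Rightarrow> ('a, 'd) config"
    and P :: "real \<Rightarrow> ('a, 'd) obs \<Rightarrow> ('a, 'd) obs" +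
  fixes \<iota> :: "('a, 'd) obs \<Rightarrow> 'h::{real_inner, banach}"
    and T :: "real \<Rightarrow> 'h \<Rightarrow> 'h"
  assumes corr_summable: "f \<in> local_L2 \<mu> \<Longrightarrow> g \<in> local_L2 \<mu> \<Longrightarrow> corr_term \<mu> f g summable_on UNIV"
    and iota_linear: "f \<in> local_L2 \<mu> \<Longrightarrow> g \<in> local_L2 \<mu> \<Longrightarrow>
      \<iota> (\<lambda>\<eta>. a * f \<eta> + b * g \<eta>) = a *\<^sub>R \<iota> f + b *\<^sub>R \<iota> g"
    and iota_inner: "f \<in> local_L2 \<mu> \<Longrightarrow> g \<in> local_L2 \<mu> \<Longrightarrow> \<iota> f \<bullet> \<iota> g = corr_form \<mu> f g"
    and iota_dense: "closure (\<iota> ` local_L2 \<mu>) = UNIV"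
    and T_bounded_linear: "t \<ge> 0 \<Longrightarrow> bounded_linear (T t)"
    and T_self_adjoint: "t \<ge> 0 \<Longrightarrow> T t u \<bullet> v = u \<bullet> T t v"
    and T_zero: "T 0 u = u"
    and T_add: "s \<ge> 0 \<Longrightarrow> t \<ge> 0 \<Longrightarrow> T (s + t) u = T s (T t u)"
    and T_continuous: "((\<lambda>t. T t u) \<longlongrightarrow> u) (at_right 0)"
    and T_induced: "t \<ge> 0 \<Longrightarrow> f \<in> local_L2 \<mu> \<Longrightarrow> g \<in> local_L2 \<mu> \<Longrightarrow>
      (corr_term \<mu> g (P t f) has_sum (\<iota> g \<bullet> T t (\<iota> f))) UNIV"
    and local_in_domain: "f \<in> local_L2 \<mu> \<Longrightarrow> \<iota> f \<in> generator_domain T"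
    and generator_nonpos: "f \<in> local_L2 \<mu> \<Longrightarrow> - (\<iota> f \<bullet> generator_of T (\<iota> f)) \<ge> 0"

definition green_kubo_integrand :: "('a, 'd::finite) config measure \<Rightarrow> ('a, 'd) interaction \<Rightarrow>
    ('a \<Rightarrow> real) \<Rightarrow> (real \<Rightarrow> ('a, 'd) obs \<Rightarrow> ('a, 'd) obs) \<Rightarrow> 'd \<Rightarrow> 'd \<Rightarrow> real \<Rightarrow> int ^ 'd \<Rightarrow> real" where
  "green_kubo_integrand \<mu> L \<xi> P \<alpha> \<beta> t x =
     (\<integral>\<eta>. current \<mu> L \<xi> \<alpha> \<eta> * P t (translate x (current \<mu> L \<xi> \<beta>)) \<eta> \<partial>\<mu>)"

definition variational_functional :: "('a, 'd::finite) config measure \<Rightarrow> ('a, 'd) interaction \<Rightarrow>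
    ('a \<Rightarrow> real) \<Rightarrow> (('a, 'd) obs \<Rightarrow> 'h::real_inner) \<Rightarrow> (real \<Rightarrow> 'h \<Rightarrow> 'h) \<Rightarrow>
    real ^ 'd \<Rightarrow> ('a, 'd) obs \<Rightarrow> real" where
  "variational_functional \<mu> L \<xi> \<iota> T l f =
     - corr_form \<mu> (\<lambda>\<eta>. \<Sum>\<alpha>\<in>UNIV. l $ \<alpha> * current \<mu> L \<xi> \<alpha> \<eta>) f
     - \<iota> f \<bullet> generator_of T (\<iota> f)"

text \<open>The assumptions on summability, integrability, existence of limits and boundedness from below
  make the quantities occurring in the formulas for \<open>D\<close> well defined.\<close>

locale diffusive_system = hilbert_system X \<mu> L \<xi> W Y P \<iota> T
  for X :: "'a measure" and \<mu> :: "('a, 'd::finite) config measure"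
    and L :: "('a, 'd) interaction" and \<xi> :: "'a \<Rightarrow> real"
    and W :: "'w measure" and Y :: "real \<Rightarrow> 'w \<Rightarrow> ('a, 'd) config"
    and P :: "real \<Rightarrow> ('a, 'd) obs \<Rightarrow> ('a, 'd) obs"
    and \<iota> :: "('a, 'd) obs \<Rightarrow> 'h::{real_inner, banach}" and T :: "real \<Rightarrow> 'h \<Rightarrow> 'h" +
  assumes compressibility_sum: "t \<ge> 0 \<Longrightarrow>
      ((\<lambda>x. two_point \<mu> \<xi> W Y x t) has_sum compressibility \<mu> \<xi> W Y) UNIV"
    and compressibility_pos: "compressibility \<mu> \<xi> W Y > 0"
    and second_moment_summable: "t > 0 \<Longrightarrow>
      (\<lambda>x. of_int (x $ \<alpha>) * of_int (x $ \<beta>) * two_point \<mu> \<xi> W Y x t) summable_on UNIV"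
    and diffusion_limit_exists: "\<exists>l. (scaled_variance \<mu> \<xi> W Y \<alpha> \<beta> \<longlongrightarrow> l) at_top"
    and green_kubo_summable: "t \<ge> 0 \<Longrightarrow> green_kubo_integrand \<mu> L \<xi> P \<alpha> \<beta> t summable_on UNIV"
    and green_kubo_integrable:
      "(\<lambda>t. \<Sum>\<^sub>\<infinity>x. green_kubo_integrand \<mu> L \<xi> P \<alpha> \<beta> t x) integrable_on {0..}"
    and green_kubo: "diffusion_matrix \<mu> \<xi> W Y $ \<alpha> $ \<beta> =
      static_diffusion_matrix \<mu> L \<xi> W Y $ \<alpha> $ \<beta> - 1 / (4 * compressibility \<mu> \<xi> W Y) *
        integral {0..} (\<lambda>t. \<Sum>\<^sub>\<infinity>x. green_kubo_integrand \<mu> L \<xi> P \<alpha> \<beta> t x)"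
    and variational_bdd_below: "bdd_below (variational_functional \<mu> L \<xi> \<iota> T l ` local_L2 \<mu>)"
    and variational_formula:
      "(\<Sum>\<alpha>\<in>UNIV. \<Sum>\<beta>\<in>UNIV. l $ \<alpha> * l $ \<beta> * diffusion_matrix \<mu> \<xi> W Y $ \<alpha> $ \<beta>) =
       (\<Sum>\<alpha>\<in>UNIV. \<Sum>\<beta>\<in>UNIV. l $ \<alpha> * l $ \<beta> * static_diffusion_matrix \<mu> L \<xi> W Y $ \<alpha> $ \<beta>) +
       1 / compressibility \<mu> \<xi> W Y * (INF f\<in>local_L2 \<mu>. variational_functional \<mu> L \<xi> \<iota> T l f)"

end

theory Submission
  imports Defs
begin

text \<open>
  The equality \<open>D = D\<^sup>s\<close> says that the infimum in the variational formula vanishes for every \<open>l\<close>.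
  The functional is a nonnegative quadratic form minus the linear form \<open>f \<mapsto> \<langle>\<Sum> l\<^sub>\<alpha> j\<^sub>\<alpha> | f\<rangle>\<close>; scaling \<open>f\<close>
  shows that its infimum is zero exactly when the linear form vanishes, that is, when the currents are
  null vectors of the degenerate scalar product (\<open>diffusion_matrix_eq_static_iff\<close>).  The theorem
  thus reduces to a statement about the scalar product alone: under a product measure, a local function
  \<open>f\<close> of mean zero is a null vector if and only if it is a gradient
  (\<open>iota_eq_zero_iff_gradient\<close>).  Gradients are null because the scalar product is a sum over all
  translates.

  For the converse, fix a translation-invariant total order on the lattice and reveal the sites from the
  largest to the smallest.  This writes \<open>f\<close> as a finite sum of martingale differences \<open>f\<^sub>x\<close>, where
  \<open>f\<^sub>x\<close> depends on the sites \<open>\<ge> x\<close> and averages to zero over the site \<open>x\<close>.  Moving each \<open>f\<^sub>x\<close> back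
  to the origin changes it by a gradient, so modulo gradients \<open>f\<close> equals a single function \<open>h\<close> that
  depends on the sites \<open>\<ge> 0\<close> and averages to zero over the site \<open>0\<close> (\<open>ex_innovation\<close>).
  Distinct translates of \<open>h\<close> are orthogonal in \<open>L\<^sup>2\<close>, because the one with the smaller base point
  averages to zero there while the other does not see that site.  Hence \<open>\<langle>h|h\<rangle>\<close> collapses to the ordinary
  norm \<open>\<langle>h\<^sup>2\<rangle>\<close> (\<open>corr_form_innovation\<close>); if \<open>f\<close> is null, so is \<open>h\<close>, whence \<open>h = 0\<close> and \<open>f\<close> is a
  gradient.

  For nearest-neighbour interactions, conservation on the bond and translation invariance make
  \<open>j\<^sub>0\<^sub>,\<^sub>-\<^sub>e\<close> the negative of a translate of \<open>j\<^sub>0\<^sub>,\<^sub>e\<close>, so that the \<open>\<alpha>\<close>-th current is twice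
  \<open>j\<^sub>0\<^sub>,\<^sub>e\<close>, \<open>e = e\<^sub>\<alpha>\<close>, modulo gradients and one is null exactly when the other is.
\<close>

section \<open>Square-integrable functions on a probability space\<close>

lemma (in prob_space) L2_integrable_mult:
  assumes "f \<in> L2 M" "g \<in> L2 M"
  shows "integrable M (\<lambda>x. f x * g x)"
proof (rule Bochner_Integration.integrable_bound)
  show "integrable M (\<lambda>x. (f x)\<^sup>2 + (g x)\<^sup>2)" "(\<lambda>x. f x * g x) \<in> borel_measurable M"
    using assms by (auto simp: L2_def)
  have "\<bar>a * b\<bar> \<le> a\<^sup>2 + b\<^sup>2" for a b :: real
    using sum_squares_bound[of "\<bar>a\<bar>" "\<bar>b\<bar>"] mult_nonneg_nonneg[OF abs_ge_zero[of a] abs_ge_zero[of b]]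
    unfolding power2_abs abs_mult by linarith
  thus "AE x in M. norm (f x * g x) \<le> norm ((f x)\<^sup>2 + (g x)\<^sup>2)" by simp
qed

lemma (in prob_space) L2_const: "(\<lambda>_. c) \<in> L2 M"
  by (simp add: L2_def)

lemma (in prob_space) L2_integrable: "f \<in> L2 M \<Longrightarrow> integrable M f"
  using L2_integrable_mult[OF _ L2_const[of 1]] by simp

lemma (in prob_space) L2_lincomb:
  assumes "f \<in> L2 M" "g \<in> L2 M"
  shows "(\<lambda>x. a * f x + b * g x) \<in> L2 M"
proof -
  have "integrable M (\<lambda>x. a\<^sup>2 * (f x * f x) + 2 * a * b * (f x * g x) + b\<^sup>2 * (g x * g x))"
    using assms by (intro Bochner_Integration.integrable_add integrable_mult_right L2_integrable_mult)
  also have "(\<lambda>x. a\<^sup>2 * (f x * f x) + 2 * a * b * (f x * g x) + b\<^sup>2 * (g x * g x)) =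
      (\<lambda>x. (a * f x + b * g x)\<^sup>2)"
    by (simp add: fun_eq_iff power2_eq_square algebra_simps)
  finally have "integrable M (\<lambda>x. (a * f x + b * g x)\<^sup>2)" .
  moreover have "(\<lambda>x. a * f x + b * g x) \<in> borel_measurable M"
    using assms unfolding L2_def by (intro borel_measurable_add borel_measurable_times) auto
  ultimately show ?thesis by (simp add: L2_def)
qed

lemma L2_cong_ae:
  assumes "f \<in> L2 M" "g \<in> borel_measurable M" "ae_eq M f g"
  shows "g \<in> L2 M"
proof -
  have "integrable M (\<lambda>x. (g x)\<^sup>2)"
    using assms by (subst integrable_cong_AE[where g = "\<lambda>x. (f x)\<^sup>2"]) (auto simp: L2_def)
  thus ?thesis using assms by (simp add: L2_def)
qed

lemma ae_zero_of_square_integral: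
  assumes "f \<in> L2 M" "(\<integral>x. f x * f x \<partial>M) = 0"
  shows "ae_eq M f (\<lambda>_. 0)"
proof -
  have "integrable M (\<lambda>x. f x * f x)"
    using assms(1) by (simp add: L2_def power2_eq_square)
  with assms(2) have "AE x in M. f x * f x = 0"
    using integral_nonneg_eq_0_iff_AE[of M "\<lambda>x. f x * f x"] by simp
  thus ?thesis by simp
qed

section \<open>Local functions and gradients under a shift-invariant measure\<close>

lemma shift_zero [simp]: "shift 0 \<eta> = \<eta>"
  and shift_shift: "shift z (shift w \<eta>) = shift (z + w) \<eta>"
  by (simp_all add: shift_def add_ac fun_eq_iff)

lemma translate_zero [simp]: "translate 0 f = f"
  and translate_translate: "translate z (translate w f) = translate (z + w) f"
  by (simp_all add: translate_def shift_shift add_ac)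

locale shift_invariant_field = prob_space \<mu>
  for \<mu> :: "('a, 'd::finite) config measure" +
  fixes X :: "'a measure"
  assumes sets_field: "sets \<mu> = sets (Pi\<^sub>M UNIV (\<lambda>_. X))"
    and distr_shift: "distr \<mu> \<mu> (shift z) = \<mu>"
begin

lemma space_field: "space \<mu> = UNIV \<rightarrow> space X"
  using sets_eq_imp_space_eq[OF sets_field] by (simp add: space_PiM PiE_UNIV_domain Pi_def)

lemma measurable_shift [measurable]: "shift z \<in> measurable \<mu> \<mu>"
proof -
  have "shift z \<in> measurable (Pi\<^sub>M UNIV (\<lambda>_. X)) (Pi\<^sub>M UNIV (\<lambda>_. X))"
    unfolding shift_def by (rule measurable_PiM_single') (auto simp: space_PiM PiE_UNIV_domain)
  thus ?thesis by (simp add: measurable_def sets_field space_field space_PiM PiE_UNIV_domain Pi_def)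
qed

lemma measurable_translate [measurable]: "f \<in> borel_measurable \<mu> \<Longrightarrow> translate z f \<in> borel_measurable \<mu>"
  unfolding translate_def by (rule measurable_compose[OF measurable_shift])

lemma AE_translate:
  assumes "AE \<eta> in \<mu>. Q \<eta>"
  shows "AE \<eta> in \<mu>. Q (shift z \<eta>)"
proof -
  have "AE \<eta> in distr \<mu> \<mu> (shift z). Q \<eta>" unfolding distr_shift by (rule assms)
  thus ?thesis by (rule AE_distrD[OF measurable_shift])
qed

lemma ae_eq_translate: "ae_eq \<mu> f g \<Longrightarrow> ae_eq \<mu> (translate z f) (translate z g)"
  unfolding translate_def by (rule AE_translate)

lemma integral_translate:
  assumes "f \<in> borel_measurable \<mu>"
  shows "(\<integral>\<eta>. translate z f \<eta> \<partial>\<mu>) = (\<integral>\<eta>. f \<eta> \<partial>\<mu>)"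
  using integral_distr[of "shift z" \<mu> \<mu> f] assms by (simp add: distr_shift translate_def)

lemma translate_L2:
  assumes "f \<in> L2 \<mu>"
  shows "translate z f \<in> L2 \<mu>"
proof -
  have "integrable \<mu> (\<lambda>\<eta>. (f (shift z \<eta>))\<^sup>2)"
    using integrable_distr[of "shift z" \<mu> \<mu> "\<lambda>\<eta>. (f \<eta>)\<^sup>2"] assms by (simp add: distr_shift L2_def)
  thus ?thesis using assms measurable_translate[of f z] by (simp add: L2_def translate_def)
qed

lemma depends_on_mono: "depends_on \<mu> A f \<Longrightarrow> A \<subseteq> B \<Longrightarrow> depends_on \<mu> B f"
  unfolding depends_on_def by blast

lemma depends_on_const: "depends_on \<mu> A (\<lambda>_. c)"
  unfolding depends_on_def by (rule bexI[of _ "\<lambda>_. c"]) auto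

lemma depends_on_lincomb:
  assumes "depends_on \<mu> A f" "depends_on \<mu> B g"
  shows "depends_on \<mu> (A \<union> B) (\<lambda>\<eta>. a * f \<eta> + b * g \<eta>)"
proof -
  obtain f' where f': "f' \<in> borel_measurable \<mu>" "ae_eq \<mu> f f'"
    "\<forall>\<eta>\<in>space \<mu>. \<forall>\<zeta>\<in>space \<mu>. (\<forall>x\<in>A. \<eta> x = \<zeta> x) \<longrightarrow> f' \<eta> = f' \<zeta>"
    using assms(1) unfolding depends_on_def by blast
  obtain g' where g': "g' \<in> borel_measurable \<mu>" "ae_eq \<mu> g g'"
    "\<forall>\<eta>\<in>space \<mu>. \<forall>\<zeta>\<in>space \<mu>. (\<forall>x\<in>B. \<eta> x = \<zeta> x) \<longrightarrow> g' \<eta> = g' \<zeta>"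
    using assms(2) unfolding depends_on_def by blast
  show ?thesis unfolding depends_on_def
  proof (rule bexI[of _ "\<lambda>\<eta>. a * f' \<eta> + b * g' \<eta>"], intro conjI ballI impI)
    show "ae_eq \<mu> (\<lambda>\<eta>. a * f \<eta> + b * g \<eta>) (\<lambda>\<eta>. a * f' \<eta> + b * g' \<eta>)"
      using f'(2) g'(2) by eventually_elim simp
    show "a * f' \<eta> + b * g' \<eta> = a * f' \<zeta> + b * g' \<zeta>"
      if "\<eta> \<in> space \<mu>" "\<zeta> \<in> space \<mu>" "\<forall>x\<in>A \<union> B. \<eta> x = \<zeta> x" for \<eta> \<zeta>
      using f'(3) g'(3) that by (metis UnI1 UnI2)
  qed (use f'(1) g'(1) in measurable)
qed

lemma depends_on_translate:
  assumes "depends_on \<mu> A f"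
  shows "depends_on \<mu> ((\<lambda>x. x + z) ` A) (translate z f)"
proof -
  obtain g where g: "g \<in> borel_measurable \<mu>" "ae_eq \<mu> f g"
    "\<forall>\<eta>\<in>space \<mu>. \<forall>\<zeta>\<in>space \<mu>. (\<forall>x\<in>A. \<eta> x = \<zeta> x) \<longrightarrow> g \<eta> = g \<zeta>"
    using assms unfolding depends_on_def by blast
  show ?thesis unfolding depends_on_def
  proof (rule bexI[of _ "translate z g"], intro conjI ballI impI)
    show "translate z g \<eta> = translate z g \<zeta>"
      if "\<eta> \<in> space \<mu>" "\<zeta> \<in> space \<mu>" "\<forall>x\<in>(\<lambda>x. x + z) ` A. \<eta> x = \<zeta> x" for \<eta> \<zeta>
      unfolding translate_def
      using that by (intro g(3)[rule_format]) (auto simp: space_field Pi_def shift_def)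
  qed (rule measurable_translate[OF g(1)] ae_eq_translate[OF g(2)])+
qed

lemma local_L2D: "f \<in> local_L2 \<mu> \<Longrightarrow> f \<in> L2 \<mu>"
  by (simp add: local_L2_def)

lemma local_L2_measurable: "f \<in> local_L2 \<mu> \<Longrightarrow> f \<in> borel_measurable \<mu>"
  by (simp add: local_L2_def L2_def)

lemma local_L2I: "f \<in> L2 \<mu> \<Longrightarrow> finite A \<Longrightarrow> depends_on \<mu> A f \<Longrightarrow> f \<in> local_L2 \<mu>"
  unfolding local_L2_def local_fun_def by blast

lemma local_L2E:
  assumes "f \<in> local_L2 \<mu>"
  obtains A where "finite A" "depends_on \<mu> A f"
  using assms unfolding local_L2_def local_fun_def by blast

lemma local_L2_const: "(\<lambda>_. c) \<in> local_L2 \<mu>"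
  by (rule local_L2I[OF L2_const finite.emptyI depends_on_const])

lemma local_L2_lincomb:
  assumes "f \<in> local_L2 \<mu>" "g \<in> local_L2 \<mu>"
  shows "(\<lambda>\<eta>. a * f \<eta> + b * g \<eta>) \<in> local_L2 \<mu>"
proof -
  obtain A where A: "finite A" "depends_on \<mu> A f" by (rule local_L2E[OF assms(1)])
  obtain B where B: "finite B" "depends_on \<mu> B g" by (rule local_L2E[OF assms(2)])
  show ?thesis
    by (rule local_L2I[OF L2_lincomb[OF assms[THEN local_L2D]] finite_UnI[OF A(1) B(1)]
          depends_on_lincomb[OF A(2) B(2)]])
qed

lemma local_L2_translate:
  assumes "f \<in> local_L2 \<mu>"
  shows "translate z f \<in> local_L2 \<mu>"
proof -
  obtain A where A: "finite A" "depends_on \<mu> A f" by (rule local_L2E[OF assms])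
  show ?thesis
    by (rule local_L2I[OF translate_L2[OF local_L2D[OF assms]] finite_imageI[OF A(1)]
          depends_on_translate[OF A(2)]])
qed

lemma local_L2_diff: "f \<in> local_L2 \<mu> \<Longrightarrow> g \<in> local_L2 \<mu> \<Longrightarrow> (\<lambda>\<eta>. f \<eta> - g \<eta>) \<in> local_L2 \<mu>"
  using local_L2_lincomb[of f g 1 "-1"] by simp

lemma local_L2_add: "f \<in> local_L2 \<mu> \<Longrightarrow> g \<in> local_L2 \<mu> \<Longrightarrow> (\<lambda>\<eta>. f \<eta> + g \<eta>) \<in> local_L2 \<mu>"
  using local_L2_lincomb[of f g 1 1] by simp

lemma local_L2_scale: "f \<in> local_L2 \<mu> \<Longrightarrow> (\<lambda>\<eta>. c * f \<eta>) \<in> local_L2 \<mu>"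
  using local_L2_lincomb[of f f c 0] by simp

lemma local_L2_sum:
  assumes "\<And>i. i \<in> I \<Longrightarrow> f i \<in> local_L2 \<mu>"
  shows "(\<lambda>\<eta>. \<Sum>i\<in>I. f i \<eta>) \<in> local_L2 \<mu>"
  using assms by (induction I rule: infinite_finite_induct)
    (auto intro: local_L2_const local_L2_add)

lemma gradient_space_cong_ae: "f \<in> gradient_space \<mu> \<Longrightarrow> ae_eq \<mu> f g \<Longrightarrow> g \<in> gradient_space \<mu>"
proof -
  assume f: "f \<in> gradient_space \<mu>" and fg: "ae_eq \<mu> f g"
  obtain F where F: "\<forall>\<alpha>. F \<alpha> \<in> local_L2 \<mu>"
    "ae_eq \<mu> f (\<lambda>\<eta>. \<Sum>\<alpha>\<in>UNIV. translate (unit_vec \<alpha>) (F \<alpha>) \<eta> - F \<alpha> \<eta>)"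
    using f unfolding gradient_space_def by blast
  have "ae_eq \<mu> g (\<lambda>\<eta>. \<Sum>\<alpha>\<in>UNIV. translate (unit_vec \<alpha>) (F \<alpha>) \<eta> - F \<alpha> \<eta>)"
    using F(2) fg by eventually_elim simp
  with F(1) show ?thesis unfolding gradient_space_def by blast
qed

lemma gradient_space_lincomb:
  assumes "f \<in> gradient_space \<mu>" "g \<in> gradient_space \<mu>"
  shows "(\<lambda>\<eta>. a * f \<eta> + b * g \<eta>) \<in> gradient_space \<mu>"
proof -
  obtain F where F: "\<And>\<alpha>. F \<alpha> \<in> local_L2 \<mu>"
    "ae_eq \<mu> f (\<lambda>\<eta>. \<Sum>\<alpha>\<in>UNIV. translate (unit_vec \<alpha>) (F \<alpha>) \<eta> - F \<alpha> \<eta>)"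
    using assms(1) unfolding gradient_space_def by blast
  obtain G where G: "\<And>\<alpha>. G \<alpha> \<in> local_L2 \<mu>"
    "ae_eq \<mu> g (\<lambda>\<eta>. \<Sum>\<alpha>\<in>UNIV. translate (unit_vec \<alpha>) (G \<alpha>) \<eta> - G \<alpha> \<eta>)"
    using assms(2) unfolding gradient_space_def by blast
  show ?thesis unfolding gradient_space_def
  proof (intro CollectI exI[of _ "\<lambda>\<alpha> \<eta>. a * F \<alpha> \<eta> + b * G \<alpha> \<eta>"] conjI allI)
    show "ae_eq \<mu> (\<lambda>\<eta>. a * f \<eta> + b * g \<eta>) (\<lambda>\<eta>. \<Sum>\<alpha>\<in>UNIV.
        translate (unit_vec \<alpha>) (\<lambda>\<eta>. a * F \<alpha> \<eta> + b * G \<alpha> \<eta>) \<eta> - (a * F \<alpha> \<eta> + b * G \<alpha> \<eta>))"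
      using F(2) G(2) by eventually_elim
        (simp only: sum_distrib_left sum.distrib[symmetric] translate_def,
          rule sum.cong[OF refl], simp add: algebra_simps)
  qed (use F(1) G(1) in \<open>auto intro: local_L2_lincomb\<close>)
qed

lemma gradient_space_add:
  "f \<in> gradient_space \<mu> \<Longrightarrow> g \<in> gradient_space \<mu> \<Longrightarrow> (\<lambda>\<eta>. f \<eta> + g \<eta>) \<in> gradient_space \<mu>"
  using gradient_space_lincomb[of f g 1 1] by simp

lemma gradient_space_uminus: "f \<in> gradient_space \<mu> \<Longrightarrow> (\<lambda>\<eta>. - f \<eta>) \<in> gradient_space \<mu>"
  using gradient_space_lincomb[of f f "-1" 0] by simp

lemma gradient_space_zero: "(\<lambda>_. 0) \<in> gradient_space \<mu>"
  unfolding gradient_space_def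
  by (intro CollectI exI[of _ "\<lambda>_ _. 0"]) (auto simp: translate_def local_L2_const)

lemma unit_difference_in_gradient_space:
  assumes "f \<in> local_L2 \<mu>"
  shows "(\<lambda>\<eta>. translate (unit_vec \<alpha>) f \<eta> - f \<eta>) \<in> gradient_space \<mu>"
  unfolding gradient_space_def
proof (intro CollectI exI[of _ "\<lambda>\<beta>. if \<beta> = \<alpha> then f else (\<lambda>_. 0)"] conjI allI)
  have "(\<Sum>\<beta>\<in>UNIV. translate (unit_vec \<beta>) (if \<beta> = \<alpha> then f else (\<lambda>_. 0)) \<eta> -
      (if \<beta> = \<alpha> then f else (\<lambda>_. 0)) \<eta>) =
    (\<Sum>\<beta>\<in>UNIV. if \<beta> = \<alpha> then translate (unit_vec \<alpha>) f \<eta> - f \<eta> else 0)" for \<eta>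
    by (intro sum.cong) (auto simp: translate_def)
  thus "ae_eq \<mu> (\<lambda>\<eta>. translate (unit_vec \<alpha>) f \<eta> - f \<eta>) (\<lambda>\<eta>. \<Sum>\<beta>\<in>UNIV.
      translate (unit_vec \<beta>) (if \<beta> = \<alpha> then f else (\<lambda>_. 0)) \<eta> -
      (if \<beta> = \<alpha> then f else (\<lambda>_. 0)) \<eta>)" by simp
qed (use assms local_L2_const in auto)

end

text \<open>Induction principle for the lattice: a property of shifts only has to be checked on unit vectors and
  for closure under the group operations.\<close>

lemma lattice_subgroup_is_everything:
  fixes H :: "(int ^ 'd::finite) set"
  assumes unit: "\<And>\<alpha>. unit_vec \<alpha> \<in> H"
    and add: "\<And>z w. z \<in> H \<Longrightarrow> w \<in> H \<Longrightarrow> z + w \<in> H"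
    and minus: "\<And>z. z \<in> H \<Longrightarrow> - z \<in> H"
  shows "z \<in> H"
proof -
  have zero: "0 \<in> H"
    using add[OF unit minus[OF unit]] by (metis add.right_inverse)
  have axis: "axis \<alpha> k \<in> H" for \<alpha> and k :: int
  proof (induction k rule: int_induct[where k = 0])
    case base
    have "axis \<alpha> (0 :: int) = 0" by (simp add: axis_def vec_eq_iff)
    thus ?case using zero by metis
  next
    case (step1 k)
    have "axis \<alpha> (k + 1) = axis \<alpha> k + unit_vec \<alpha>" by (simp add: unit_vec_def axis_def vec_eq_iff)
    thus ?case using add[OF step1(2) unit] by metis
  next
    case (step2 k)
    have "axis \<alpha> (k - 1) = axis \<alpha> k + - unit_vec \<alpha>" by (simp add: unit_vec_def axis_def vec_eq_iff)
    thus ?case using add[OF step2(2) minus[OF unit]] by metis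
  qed
  have "(\<Sum>\<alpha>\<in>I. axis \<alpha> (z $ \<alpha>)) \<in> H" if "finite I" for I
    using that by (induction I) (auto intro: zero add axis)
  moreover have "z = (\<Sum>\<alpha>\<in>UNIV. axis \<alpha> (z $ \<alpha>))"
    by (simp add: vec_eq_iff axis_def)
  ultimately show ?thesis by (metis finite)
qed

context shift_invariant_field
begin

text \<open>Telescoping along a lattice path: the shifts for which all differences are gradients form a subgroup
  that contains the unit vectors.\<close>

lemma difference_in_gradient_space:
  assumes "f \<in> local_L2 \<mu>"
  shows "(\<lambda>\<eta>. translate z f \<eta> - f \<eta>) \<in> gradient_space \<mu>"
proof -
  let ?H = "{z. \<forall>f\<in>local_L2 \<mu>. (\<lambda>\<eta>. translate z f \<eta> - f \<eta>) \<in> gradient_space \<mu>}"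
  have "z \<in> ?H"
  proof (rule lattice_subgroup_is_everything)
    show "unit_vec \<alpha> \<in> ?H" for \<alpha>
      using unit_difference_in_gradient_space by blast
    show "z + w \<in> ?H" if "z \<in> ?H" "w \<in> ?H" for z w
    proof (intro CollectI ballI)
      fix f assume f: "f \<in> local_L2 \<mu>"
      have "(\<lambda>\<eta>. (translate z (translate w f) \<eta> - translate w f \<eta>) + (translate w f \<eta> - f \<eta>)) \<in> gradient_space \<mu>"
        using that f local_L2_translate by (intro gradient_space_add) auto
      thus "(\<lambda>\<eta>. translate (z + w) f \<eta> - f \<eta>) \<in> gradient_space \<mu>"
        by (simp add: translate_translate)
    qed
    show "- z \<in> ?H" if "z \<in> ?H" for z
    proof (intro CollectI ballI)
      fix f assume f: "f \<in> local_L2 \<mu>"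
      have "(\<lambda>\<eta>. - (translate z (translate (- z) f) \<eta> - translate (- z) f \<eta>)) \<in> gradient_space \<mu>"
        using that f local_L2_translate by (intro gradient_space_uminus) auto
      thus "(\<lambda>\<eta>. translate (- z) f \<eta> - f \<eta>) \<in> gradient_space \<mu>"
        by (simp add: translate_translate)
    qed
  qed
  with assms show ?thesis by blast
qed

end

section \<open>A translation-invariant total order on the lattice\<close>

text \<open>The positive cone of the lexicographic order, for an arbitrary enumeration of the coordinates:
  the first nonzero coordinate is positive.  The order itself is \<open>x < y \<longleftrightarrow> y - x \<in> lex_positive\<close>; defining it
  by a cone makes the translation invariance automatic.\<close>

definition lex_positive :: "(int ^ 'd::finite) set" where
  "lex_positive = {x. \<exists>\<alpha>. x $ \<alpha> > 0 \<and> (\<forall>\<beta>. to_nat_on UNIV \<beta> < to_nat_on UNIV \<alpha> \<longrightarrow> x $ \<beta> = 0)}"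

lemma zero_not_lex_positive: "0 \<notin> lex_positive"
  by (simp add: lex_positive_def)

lemma lex_positive_add:
  fixes x y :: "int ^ 'd::finite"
  assumes "x \<in> lex_positive" "y \<in> lex_positive"
  shows "x + y \<in> lex_positive"
proof -
  have inj: "inj (to_nat_on (UNIV :: 'd set))"
    by (rule inj_on_to_nat_on) (simp add: countable_finite)
  obtain \<alpha> where a: "x $ \<alpha> > 0" "\<And>\<beta>. to_nat_on UNIV \<beta> < to_nat_on UNIV \<alpha> \<Longrightarrow> x $ \<beta> = 0"
    using assms(1) by (auto simp: lex_positive_def)
  obtain \<beta> where b: "y $ \<beta> > 0" "\<And>\<gamma>. to_nat_on UNIV \<gamma> < to_nat_on UNIV \<beta> \<Longrightarrow> y $ \<gamma> = 0"
    using assms(2) by (auto simp: lex_positive_def)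
  consider "to_nat_on UNIV \<alpha> < to_nat_on UNIV \<beta>" | "to_nat_on UNIV \<beta> < to_nat_on UNIV \<alpha>" | "\<alpha> = \<beta>"
    using inj by (meson injD linorder_neqE_nat)
  thus ?thesis
  proof cases
    case 1 thus ?thesis using a b unfolding lex_positive_def by (intro CollectI exI[of _ \<alpha>]) auto
  next
    case 2 thus ?thesis using a b unfolding lex_positive_def by (intro CollectI exI[of _ \<beta>]) auto
  next
    case 3 thus ?thesis using a b unfolding lex_positive_def by (intro CollectI exI[of _ \<beta>]) auto
  qed
qed

lemma lex_positive_total:
  fixes x :: "int ^ 'd::finite"
  assumes "x \<noteq> 0"
  shows "x \<in> lex_positive \<or> - x \<in> lex_positive"
proof -
  obtain \<gamma> where "x $ \<gamma> \<noteq> 0" using assms by (auto simp: vec_eq_iff)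
  then obtain \<alpha> where a: "x $ \<alpha> \<noteq> 0" "\<And>\<beta>. x $ \<beta> \<noteq> 0 \<Longrightarrow> to_nat_on UNIV \<alpha> \<le> to_nat_on UNIV \<beta>"
    using ex_has_least_nat[of "\<lambda>\<alpha>. x $ \<alpha> \<noteq> 0" \<gamma> "to_nat_on UNIV"] by blast
  hence z: "x $ \<beta> = 0" if "to_nat_on UNIV \<beta> < to_nat_on UNIV \<alpha>" for \<beta>
    using that not_le by blast
  from a(1) consider "x $ \<alpha> > 0" | "x $ \<alpha> < 0" by linarith
  thus ?thesis using z unfolding lex_positive_def by cases (force, force)
qed

lemma finite_lex_minimum:
  fixes A :: "(int ^ 'd::finite) set"
  assumes "finite A" "A \<noteq> {}"
  obtains x where "x \<in> A" "\<And>y. y \<in> A - {x} \<Longrightarrow> y - x \<in> lex_positive"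
proof -
  have "\<exists>x\<in>A. \<forall>y\<in>A - {x}. y - x \<in> lex_positive"
    using assms
  proof (induction rule: finite_ne_induct)
    case (singleton x) show ?case by simp
  next
    case (insert a A)
    then obtain x where x: "x \<in> A" "\<And>y. y \<in> A - {x} \<Longrightarrow> y - x \<in> lex_positive" by blast
    have "x \<noteq> a" using insert x(1) by blast
    hence "a - x \<in> lex_positive \<or> x - a \<in> lex_positive"
      using lex_positive_total[of "a - x"] by simp
    thus ?case
    proof
      assume "a - x \<in> lex_positive"
      thus ?case using x by (intro bexI[of _ x]) auto
    next
      assume ax: "x - a \<in> lex_positive"
      have "y - a \<in> lex_positive" if "y \<in> A" for y
        using lex_positive_add[OF ax x(2)[of y]] ax that by (cases "y = x") auto
      thus ?case by (intro bexI[of _ a]) auto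
    qed
  qed
  thus ?thesis using that by blast
qed

section \<open>Averaging over one site of a product measure\<close>

text \<open>For a product measure this is the conditional expectation given all coordinates other than \<open>x\<close>.
  Unlike the abstract conditional expectation it preserves pointwise dependence on finitely many
  coordinates.\<close>

definition site_average ::
  "'a measure \<Rightarrow> int ^ 'd::finite \<Rightarrow> ('a, 'd) obs \<Rightarrow> ('a, 'd) obs" where
  "site_average \<nu> x f = (\<lambda>\<eta>. \<integral>a. f (\<eta>(x := a)) \<partial>\<nu>)"

locale product_field = shift_invariant_field \<mu> \<nu>
  for \<mu> :: "('a, 'd::finite) config measure" and \<nu> :: "'a measure" +
  assumes prob_marginal: "prob_space \<nu>"
    and product: "\<mu> = Pi\<^sub>M UNIV (\<lambda>_. \<nu>)"
begin

sublocale marginal: prob_space \<nu> by (rule prob_marginal)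

sublocale pair: pair_prob_space \<mu> \<nu> ..

lemma measurable_resample: "(\<lambda>(\<eta>, a). \<eta>(x := a)) \<in> measurable (\<mu> \<Otimes>\<^sub>M \<nu>) \<mu>"
proof -
  have "(\<lambda>p. (fst p)(x := snd p)) \<in> measurable (Pi\<^sub>M UNIV (\<lambda>_. \<nu>) \<Otimes>\<^sub>M \<nu>) (Pi\<^sub>M UNIV (\<lambda>_. \<nu>))"
    by (rule measurable_fun_upd[where J = UNIV]) auto
  thus ?thesis by (simp add: product case_prod_beta')
qed

text \<open>Replacing one coordinate by an independent copy does not change a product measure: cylinder sets
  have the right mass because the factor of the removed coordinate is replaced by an equal one.  All
  properties of \<open>site_average\<close> come from this by Fubini.\<close>

lemma distr_resample: "distr (\<mu> \<Otimes>\<^sub>M \<nu>) \<mu> (\<lambda>(\<eta>, a). \<eta>(x := a)) = \<mu>"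
proof -
  interpret P: product_prob_space "\<lambda>_. \<nu>" "UNIV :: (int ^ 'd) set"
    by unfold_locales
  have "distr (\<mu> \<Otimes>\<^sub>M \<nu>) \<mu> (\<lambda>(\<eta>, a). \<eta>(x := a)) = Pi\<^sub>M UNIV (\<lambda>_. \<nu>)"
  proof (rule P.PiM_eq)
    show "sets (distr (\<mu> \<Otimes>\<^sub>M \<nu>) \<mu> (\<lambda>(\<eta>, a). \<eta>(x := a))) = sets (Pi\<^sub>M UNIV (\<lambda>_. \<nu>))"
      by (simp add: product)
  next
    fix J :: "(int ^ 'd) set" and F
    assume J: "finite J" and F: "\<And>j. j \<in> J \<Longrightarrow> F j \<in> sets \<nu>"
    let ?E = "\<lambda>J. prod_emb UNIV (\<lambda>_. \<nu>) J (Pi\<^sub>E J F)"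
    let ?Fx = "if x \<in> J then F x else space \<nu>"
    have E_sets: "?E K \<in> sets \<mu>" if "K \<subseteq> J" for K
      unfolding product using that J F by (intro sets_PiM_I) (auto intro: finite_subset)
    have Fx: "?Fx \<in> sets \<nu>" using F by auto
    have "emeasure (distr (\<mu> \<Otimes>\<^sub>M \<nu>) \<mu> (\<lambda>(\<eta>, a). \<eta>(x := a))) (?E J) =
        emeasure (\<mu> \<Otimes>\<^sub>M \<nu>) ((\<lambda>(\<eta>, a). \<eta>(x := a)) -` ?E J \<inter> space (\<mu> \<Otimes>\<^sub>M \<nu>))"
      using E_sets by (intro emeasure_distr measurable_resample) auto
    also have "(\<lambda>(\<eta>, a). \<eta>(x := a)) -` ?E J \<inter> space (\<mu> \<Otimes>\<^sub>M \<nu>) = ?E (J - {x}) \<times> ?Fx"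
    proof -
      have E_iff: "\<eta> \<in> ?E K \<longleftrightarrow> (\<forall>j. \<eta> j \<in> space \<nu>) \<and> (\<forall>j\<in>K. \<eta> j \<in> F j)" for \<eta> K
        by (auto simp: prod_emb_iff restrict_PiE_iff)
      have F_space: "F j \<subseteq> space \<nu>" if "j \<in> J" for j
        using sets.sets_into_space[OF F[OF that]] .
      have "\<eta>(x := a) \<in> ?E J \<and> \<eta> \<in> space \<mu> \<and> a \<in> space \<nu> \<longleftrightarrow> \<eta> \<in> ?E (J - {x}) \<and> a \<in> ?Fx" for \<eta> a
        unfolding E_iff space_field Pi_iff fun_upd_apply using F_space[of x] by (cases "x \<in> J") auto
      thus ?thesis
        by (simp only: set_eq_iff split_paired_All vimage_eq Int_iff space_pair_measure mem_Times_iff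
            prod.case fst_conv snd_conv) blast
    qed
    also have "emeasure (\<mu> \<Otimes>\<^sub>M \<nu>) \<dots> = emeasure \<mu> (?E (J - {x})) * emeasure \<nu> ?Fx"
      by (intro marginal.emeasure_pair_measure_Times E_sets Fx) auto
    also have "emeasure \<mu> (?E (J - {x})) = (\<Prod>j\<in>J - {x}. emeasure \<nu> (F j))"
      unfolding product using J F by (intro P.emeasure_PiM_emb) auto
    also have "\<dots> * emeasure \<nu> ?Fx = (\<Prod>j\<in>J. emeasure \<nu> (F j))"
      using J by (cases "x \<in> J") (simp_all add: prod.remove[of J x] mult.commute marginal.emeasure_space_1)
    finally show "emeasure (distr (\<mu> \<Otimes>\<^sub>M \<nu>) \<mu> (\<lambda>(\<eta>, a). \<eta>(x := a))) (?E J) =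
      (\<Prod>j\<in>J. emeasure \<nu> (F j))" .
  qed
  thus ?thesis by (simp only: product)
qed

lemma integrable_resample:
  fixes f :: "('a, 'd) obs"
  assumes "integrable \<mu> f"
  shows "integrable (\<mu> \<Otimes>\<^sub>M \<nu>) (\<lambda>(\<eta>, a). f (\<eta>(x := a)))"
  using integrable_distr[OF measurable_resample[of x], unfolded distr_resample, OF assms]
  by (simp add: case_prod_beta')

lemma
  fixes f :: "('a, 'd) obs"
  assumes "integrable \<mu> f"
  shows AE_integrable_resample: "AE \<eta> in \<mu>. integrable \<nu> (\<lambda>a. f (\<eta>(x := a)))"
    and integrable_site_average: "integrable \<mu> (site_average \<nu> x f)"
    and integral_site_average: "(\<integral>\<eta>. site_average \<nu> x f \<eta> \<partial>\<mu>) = (\<integral>\<eta>. f \<eta> \<partial>\<mu>)"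
proof -
  note int = integrable_resample[OF assms, of x]
  show "AE \<eta> in \<mu>. integrable \<nu> (\<lambda>a. f (\<eta>(x := a)))"
    using pair.AE_integrable_fst'[OF int] by simp
  show "integrable \<mu> (site_average \<nu> x f)"
    using pair.integrable_fst'[OF int] by (simp add: site_average_def)
  have "(\<integral>\<eta>. site_average \<nu> x f \<eta> \<partial>\<mu>) = (\<integral>p. (\<lambda>(\<eta>, a). f (\<eta>(x := a))) p \<partial>(\<mu> \<Otimes>\<^sub>M \<nu>))"
    using pair.integral_fst'[OF int] by (simp add: site_average_def)
  also have "\<dots> = (\<integral>\<eta>. f \<eta> \<partial>\<mu>)"
    using integral_distr[OF measurable_resample[of x] borel_measurable_integrable[OF assms]]
    unfolding distr_resample by (simp add: case_prod_beta')
  finally show "(\<integral>\<eta>. site_average \<nu> x f \<eta> \<partial>\<mu>) = (\<integral>\<eta>. f \<eta> \<partial>\<mu>)" .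
qed

text \<open>Jensen's inequality: the square of the average is at most the average of the square, the difference
  being the variance of \<open>f\<close> in the averaged coordinate.\<close>

lemma site_average_L2:
  assumes "f \<in> L2 \<mu>"
  shows "site_average \<nu> x f \<in> L2 \<mu>"
proof -
  have int: "integrable \<mu> f" "integrable \<mu> (\<lambda>\<eta>. (f \<eta>)\<^sup>2)"
    using L2_integrable[OF assms] assms by (simp_all add: L2_def)
  have meas: "site_average \<nu> x f \<in> borel_measurable \<mu>"
    using integrable_site_average[OF int(1)] by simp
  have "integrable \<mu> (\<lambda>\<eta>. (site_average \<nu> x f \<eta>)\<^sup>2)"
  proof (rule Bochner_Integration.integrable_bound)
    show "integrable \<mu> (site_average \<nu> x (\<lambda>\<eta>. (f \<eta>)\<^sup>2))"
      by (rule integrable_site_average[OF int(2)])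
    show "AE \<eta> in \<mu>. norm ((site_average \<nu> x f \<eta>)\<^sup>2) \<le> norm (site_average \<nu> x (\<lambda>\<eta>. (f \<eta>)\<^sup>2) \<eta>)"
      using AE_integrable_resample[OF int(1), of x] AE_integrable_resample[OF int(2), of x]
    proof eventually_elim
      case (elim \<eta>)
      have "0 \<le> (\<integral>a. (f (\<eta>(x := a)) - site_average \<nu> x f \<eta>)\<^sup>2 \<partial>\<nu>)" by simp
      also have "\<dots> = site_average \<nu> x (\<lambda>\<eta>. (f \<eta>)\<^sup>2) \<eta> - (site_average \<nu> x f \<eta>)\<^sup>2"
        using marginal.variance_eq[OF elim] by (simp add: site_average_def)
      finally show ?case by simp
    qed
  qed (use meas in measurable)
  thus ?thesis using meas by (simp add: L2_def)
qed

text \<open>A factor that does not see the site \<open>x\<close> can be pulled out of the average.\<close>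

lemma site_average_adjoint:
  assumes f: "f \<in> L2 \<mu>" and g: "g \<in> L2 \<mu>"
    and dep: "depends_on \<mu> A g" "x \<notin> A"
  shows "(\<integral>\<eta>. site_average \<nu> x f \<eta> * g \<eta> \<partial>\<mu>) = (\<integral>\<eta>. f \<eta> * g \<eta> \<partial>\<mu>)"
proof -
  obtain g' where g': "g' \<in> borel_measurable \<mu>" "ae_eq \<mu> g g'"
    "\<forall>\<eta>\<in>space \<mu>. \<forall>\<zeta>\<in>space \<mu>. (\<forall>x\<in>A. \<eta> x = \<zeta> x) \<longrightarrow> g' \<eta> = g' \<zeta>"
    using dep(1) unfolding depends_on_def by blast
  have g'_L2: "g' \<in> L2 \<mu>" by (rule L2_cong_ae[OF g g'(1,2)])
  have meas: "f \<in> borel_measurable \<mu>" "g \<in> borel_measurable \<mu>" "site_average \<nu> x f \<in> borel_measurable \<mu>"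
    using f g site_average_L2[OF f] by (simp_all add: L2_def)
  have pull_out: "site_average \<nu> x (\<lambda>\<eta>. f \<eta> * g' \<eta>) \<eta> = site_average \<nu> x f \<eta> * g' \<eta>"
    if "\<eta> \<in> space \<mu>" for \<eta>
  proof -
    have "f (\<eta>(x := a)) * g' (\<eta>(x := a)) = f (\<eta>(x := a)) * g' \<eta>" if "a \<in> space \<nu>" for a
    proof -
      have "\<eta>(x := a) \<in> space \<mu>" using \<open>\<eta> \<in> space \<mu>\<close> that by (auto simp: space_field Pi_iff)
      moreover have "\<forall>y\<in>A. (\<eta>(x := a)) y = \<eta> y" using dep(2) by auto
      ultimately show ?thesis using g'(3) \<open>\<eta> \<in> space \<mu>\<close> by metis
    qed
    hence "site_average \<nu> x (\<lambda>\<eta>. f \<eta> * g' \<eta>) \<eta> = (\<integral>a. f (\<eta>(x := a)) * g' \<eta> \<partial>\<nu>)"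
      unfolding site_average_def by (intro Bochner_Integration.integral_cong) auto
    thus ?thesis by (simp add: site_average_def)
  qed
  have "(\<integral>\<eta>. site_average \<nu> x f \<eta> * g \<eta> \<partial>\<mu>) = (\<integral>\<eta>. site_average \<nu> x f \<eta> * g' \<eta> \<partial>\<mu>)"
    by (intro integral_cong_AE borel_measurable_times meas g'(1)) (use g'(2) in \<open>eventually_elim; simp\<close>)
  also have "\<dots> = (\<integral>\<eta>. site_average \<nu> x (\<lambda>\<eta>. f \<eta> * g' \<eta>) \<eta> \<partial>\<mu>)"
    by (intro Bochner_Integration.integral_cong) (simp_all add: pull_out)
  also have "\<dots> = (\<integral>\<eta>. f \<eta> * g' \<eta> \<partial>\<mu>)"
    by (rule integral_site_average[OF L2_integrable_mult[OF f g'_L2]])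
  also have "\<dots> = (\<integral>\<eta>. f \<eta> * g \<eta> \<partial>\<mu>)"
    by (intro integral_cong_AE borel_measurable_times meas g'(1)) (use g'(2) in \<open>eventually_elim; simp\<close>)
  finally show ?thesis .
qed

section \<open>Concentrating a local function at the origin\<close>

text \<open>The functions \<open>h\<close> of the sites \<open>\<ge> 0\<close> whose average over the site \<open>0\<close> vanishes.  The last
  condition is stated by orthogonality, which is the form in which it is used and which is visibly
  stable under sums.\<close>

definition innovation :: "('a, 'd) obs set" where
  "innovation = {h \<in> local_L2 \<mu>. depends_on \<mu> (insert 0 lex_positive) h \<and>
     (\<forall>g\<in>L2 \<mu>. depends_on \<mu> lex_positive g \<longrightarrow> (\<integral>\<eta>. h \<eta> * g \<eta> \<partial>\<mu>) = 0)}"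

lemma innovation_zero: "(\<lambda>_. 0) \<in> innovation"
  by (simp add: innovation_def local_L2_const depends_on_const)

lemma innovation_add:
  assumes h: "h \<in> innovation" and k: "k \<in> innovation"
  shows "(\<lambda>\<eta>. h \<eta> + k \<eta>) \<in> innovation"
proof -
  have hk: "h \<in> local_L2 \<mu>" "k \<in> local_L2 \<mu>" using h k by (simp_all add: innovation_def)
  have "(\<integral>\<eta>. (h \<eta> + k \<eta>) * g \<eta> \<partial>\<mu>) = 0" if "g \<in> L2 \<mu>" "depends_on \<mu> lex_positive g" for g
  proof -
    have "(\<integral>\<eta>. (h \<eta> + k \<eta>) * g \<eta> \<partial>\<mu>) = (\<integral>\<eta>. h \<eta> * g \<eta> \<partial>\<mu>) + (\<integral>\<eta>. k \<eta> * g \<eta> \<partial>\<mu>)"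
      unfolding distrib_right
      by (intro Bochner_Integration.integral_add L2_integrable_mult local_L2D hk that(1))
    also have "\<dots> = 0" using h k that unfolding innovation_def by simp
    finally show ?thesis .
  qed
  moreover have "depends_on \<mu> (insert 0 lex_positive) (\<lambda>\<eta>. h \<eta> + k \<eta>)"
    using depends_on_lincomb[of "insert 0 lex_positive" h "insert 0 lex_positive" k 1 1] h k
    unfolding innovation_def by simp
  ultimately show ?thesis using local_L2_add[OF hk] unfolding innovation_def by blast
qed

text \<open>One martingale difference: the part of \<open>f\<close> removed by averaging over the smallest site \<open>x\<close> of its
  support, carried to the origin.  A test function of the sites \<open>> 0\<close> is carried by the opposite shift to
  one of the sites \<open>> x\<close>, which cannot distinguish \<open>f\<close> from its average.\<close>

lemma translate_site_fluctuation_innovation: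
  assumes f: "f \<in> L2 \<mu>" and A: "finite A" "depends_on \<mu> A f" "depends_on \<mu> A (site_average \<nu> x f)"
    and min: "\<And>y. y \<in> A - {x} \<Longrightarrow> y - x \<in> lex_positive"
  shows "translate (- x) (\<lambda>\<eta>. f \<eta> - site_average \<nu> x f \<eta>) \<in> innovation"
proof -
  let ?u = "\<lambda>\<eta>. f \<eta> - site_average \<nu> x f \<eta>"
  have u: "?u \<in> local_L2 \<mu>"
    by (intro local_L2_diff local_L2I[OF f A(1,2)] local_L2I[OF site_average_L2[OF f] A(1,3)])
  have u_meas: "?u \<in> borel_measurable \<mu>" using u by (rule local_L2_measurable)
  have "depends_on \<mu> (A \<union> A) ?u"
    using depends_on_lincomb[OF A(2,3), of 1 "-1"] by simp
  hence "depends_on \<mu> ((\<lambda>y. y + - x) ` (A \<union> A)) (translate (- x) ?u)"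
    by (rule depends_on_translate)
  hence "depends_on \<mu> (insert 0 lex_positive) (translate (- x) ?u)"
    by (rule depends_on_mono) (use min in fastforce)
  moreover have "(\<integral>\<eta>. translate (- x) ?u \<eta> * g \<eta> \<partial>\<mu>) = 0"
    if g: "g \<in> L2 \<mu>" "depends_on \<mu> lex_positive g" for g
  proof -
    have g_meas: "g \<in> borel_measurable \<mu>" using g by (simp add: L2_def)
    have tg: "translate x g \<in> L2 \<mu>" by (rule translate_L2[OF g(1)])
    have "(\<integral>\<eta>. translate (- x) ?u \<eta> * g \<eta> \<partial>\<mu>) =
        (\<integral>\<eta>. translate x (\<lambda>\<eta>. translate (- x) ?u \<eta> * g \<eta>) \<eta> \<partial>\<mu>)"
      by (rule integral_translate[symmetric])
        (intro borel_measurable_times measurable_translate u_meas g_meas)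
    also have "\<dots> = (\<integral>\<eta>. ?u \<eta> * translate x g \<eta> \<partial>\<mu>)"
      by (simp add: translate_def shift_shift)
    also have "\<dots> = (\<integral>\<eta>. f \<eta> * translate x g \<eta> \<partial>\<mu>) -
        (\<integral>\<eta>. site_average \<nu> x f \<eta> * translate x g \<eta> \<partial>\<mu>)"
      unfolding left_diff_distrib
      by (intro Bochner_Integration.integral_diff L2_integrable_mult f tg site_average_L2)
    also have "\<dots> = 0"
    proof -
      have "w + x \<noteq> x" if "w \<in> lex_positive" for w
        using that zero_not_lex_positive by force
      hence "x \<notin> (\<lambda>w. w + x) ` lex_positive" by (metis imageE)
      thus ?thesis using site_average_adjoint[OF f tg depends_on_translate[OF g(2)]] by simp
    qed
    finally show ?thesis .
  qed
  ultimately show ?thesis using local_L2_translate[OF u] unfolding innovation_def by blast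
qed

lemma site_average_cong:
  assumes "\<And>\<eta> \<zeta>. \<eta> \<in> space \<mu> \<Longrightarrow> \<zeta> \<in> space \<mu> \<Longrightarrow> (\<forall>y\<in>A. \<eta> y = \<zeta> y) \<Longrightarrow> f \<eta> = f \<zeta>"
    and "\<eta> \<in> space \<mu>" "\<zeta> \<in> space \<mu>" "\<forall>y\<in>A - {x}. \<eta> y = \<zeta> y"
  shows "site_average \<nu> x f \<eta> = site_average \<nu> x f \<zeta>"
  unfolding site_average_def
proof (rule Bochner_Integration.integral_cong[OF refl])
  fix a assume "a \<in> space \<nu>"
  thus "f (\<eta>(x := a)) = f (\<zeta>(x := a))"
    using assms(2-4) by (intro assms(1)) (auto simp: space_field Pi_iff)
qed

text \<open>Averaging over the smallest site of the support shrinks the support, so this is an induction on it: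
  the removed part is an innovation up to a gradient, and the rest is handled by the induction
  hypothesis.  When no site is left the function is constant, hence equal to its mean.  The induction
  runs over functions with pointwise dependence; a local function is replaced by such a representative
  first.\<close>

lemma ex_innovation:
  assumes "f \<in> local_L2 \<mu>"
  obtains h where "h \<in> innovation" "(\<lambda>\<eta>. f \<eta> - (\<integral>\<zeta>. f \<zeta> \<partial>\<mu>) - h \<eta>) \<in> gradient_space \<mu>"
proof -
  have pointwise: "\<exists>h\<in>innovation. (\<lambda>\<eta>. f \<eta> - (\<integral>\<zeta>. f \<zeta> \<partial>\<mu>) - h \<eta>) \<in> gradient_space \<mu>"
    if "finite A" "f \<in> L2 \<mu>"
      "\<And>\<eta> \<zeta>. \<eta> \<in> space \<mu> \<Longrightarrow> \<zeta> \<in> space \<mu> \<Longrightarrow> (\<forall>y\<in>A. \<eta> y = \<zeta> y) \<Longrightarrow> f \<eta> = f \<zeta>" for A f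
    using that
  proof (induction A arbitrary: f rule: finite_psubset_induct)
    case (psubset A)
    have f_meas: "f \<in> borel_measurable \<mu>" using psubset.prems(1) by (simp add: L2_def)
    show ?case
    proof (cases "A = {}")
      case True
      obtain \<eta>0 where "\<eta>0 \<in> space \<mu>" using not_empty by blast
      hence const: "f \<eta> = f \<eta>0" if "\<eta> \<in> space \<mu>" for \<eta>
        using psubset.prems(2)[OF that] True by blast
      hence "(\<integral>\<zeta>. f \<zeta> \<partial>\<mu>) = (\<integral>\<zeta>. f \<eta>0 \<partial>\<mu>)" by (intro Bochner_Integration.integral_cong) auto
      hence mean: "(\<integral>\<zeta>. f \<zeta> \<partial>\<mu>) = f \<eta>0" by (simp add: prob_space)
      have "ae_eq \<mu> (\<lambda>_. 0) (\<lambda>\<eta>. f \<eta> - (\<integral>\<zeta>. f \<zeta> \<partial>\<mu>) - 0)"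
        unfolding mean by (rule AE_I2) (metis const diff_self diff_zero)
      hence grad: "(\<lambda>\<eta>. f \<eta> - (\<integral>\<zeta>. f \<zeta> \<partial>\<mu>) - 0) \<in> gradient_space \<mu>"
        by (rule gradient_space_cong_ae[OF gradient_space_zero])
      show ?thesis by (rule bexI[where x = "\<lambda>_. 0"], rule grad, rule innovation_zero)
    next
      case False
      from finite_lex_minimum[OF psubset.hyps(1) False] obtain x where
        x: "x \<in> A" and min: "\<And>y. y \<in> A - {x} \<Longrightarrow> y - x \<in> lex_positive" by blast
      let ?m = "site_average \<nu> x f" and ?u = "\<lambda>\<eta>. f \<eta> - site_average \<nu> x f \<eta>"
      note m = site_average_L2[OF psubset.prems(1), of x]
      have m_dep: "?m \<eta> = ?m \<zeta>"
        if "\<eta> \<in> space \<mu>" "\<zeta> \<in> space \<mu>" "\<forall>y\<in>A - {x}. \<eta> y = \<zeta> y" for \<eta> \<zeta>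
        using psubset.prems(2) that by (rule site_average_cong)
      have m_mean: "(\<integral>\<zeta>. ?m \<zeta> \<partial>\<mu>) = (\<integral>\<zeta>. f \<zeta> \<partial>\<mu>)"
        by (rule integral_site_average[OF L2_integrable[OF psubset.prems(1)]])
      obtain h where h: "h \<in> innovation" "(\<lambda>\<eta>. ?m \<eta> - (\<integral>\<zeta>. ?m \<zeta> \<partial>\<mu>) - h \<eta>) \<in> gradient_space \<mu>"
      proof -
        have "\<exists>h\<in>innovation. (\<lambda>\<eta>. ?m \<eta> - (\<integral>\<zeta>. ?m \<zeta> \<partial>\<mu>) - h \<eta>) \<in> gradient_space \<mu>"
          by (rule psubset.IH[of "A - {x}"]) (use x m m_dep in blast)+
        thus thesis using that by (elim bexE)
      qed
      have A_f: "depends_on \<mu> A f"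
        unfolding depends_on_def by (intro bexI[OF _ f_meas] conjI ballI impI psubset.prems(2)) simp_all
      have A_m: "depends_on \<mu> A ?m"
        unfolding depends_on_def using m by (intro bexI[of _ ?m] conjI ballI impI m_dep) (simp_all add: L2_def)
      have u: "?u \<in> local_L2 \<mu>"
        by (intro local_L2_diff local_L2I[OF psubset.prems(1) psubset.hyps(1) A_f]
            local_L2I[OF m psubset.hyps(1) A_m])
      let ?k = "translate (- x) ?u"
      have k: "?k \<in> innovation"
        by (rule translate_site_fluctuation_innovation[OF psubset.prems(1) psubset.hyps(1) A_f A_m min])
      have "(\<lambda>\<eta>. (?m \<eta> - (\<integral>\<zeta>. ?m \<zeta> \<partial>\<mu>) - h \<eta>) + - (?k \<eta> - ?u \<eta>)) \<in> gradient_space \<mu>"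
        by (intro gradient_space_add gradient_space_uminus difference_in_gradient_space u h(2))
      hence grad: "(\<lambda>\<eta>. f \<eta> - (\<integral>\<zeta>. f \<zeta> \<partial>\<mu>) - (h \<eta> + ?k \<eta>)) \<in> gradient_space \<mu>"
        by (simp add: m_mean algebra_simps)
      show ?thesis
        by (rule bexI[where x = "\<lambda>\<eta>. h \<eta> + ?k \<eta>"], rule grad, rule innovation_add[OF h(1) k])
    qed
  qed
  obtain A where A: "finite A" "depends_on \<mu> A f" by (rule local_L2E[OF assms])
  then obtain g where g: "g \<in> borel_measurable \<mu>" "ae_eq \<mu> f g"
    "\<forall>\<eta>\<in>space \<mu>. \<forall>\<zeta>\<in>space \<mu>. (\<forall>y\<in>A. \<eta> y = \<zeta> y) \<longrightarrow> g \<eta> = g \<zeta>"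
    unfolding depends_on_def by blast
  have mean: "(\<integral>\<zeta>. g \<zeta> \<partial>\<mu>) = (\<integral>\<zeta>. f \<zeta> \<partial>\<mu>)"
    by (intro integral_cong_AE local_L2_measurable[OF assms] g(1)) (use g(2) in \<open>eventually_elim; simp\<close>)
  obtain h where h: "h \<in> innovation" "(\<lambda>\<eta>. g \<eta> - (\<integral>\<zeta>. g \<zeta> \<partial>\<mu>) - h \<eta>) \<in> gradient_space \<mu>"
    using pointwise[OF A(1) L2_cong_ae[OF local_L2D[OF assms] g(1,2)]] g(3) by blast
  have "ae_eq \<mu> (\<lambda>\<eta>. g \<eta> - (\<integral>\<zeta>. g \<zeta> \<partial>\<mu>) - h \<eta>) (\<lambda>\<eta>. f \<eta> - (\<integral>\<zeta>. f \<zeta> \<partial>\<mu>) - h \<eta>)"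
    using g(2) by eventually_elim (simp add: mean)
  from that[OF h(1) gradient_space_cong_ae[OF h(2) this]] show ?thesis .
qed

text \<open>Only the term of the zero shift survives: for a positive shift the translate is a function of the
  sites \<open>> 0\<close>, and for a negative shift the two factors exchange their roles.\<close>

lemma corr_form_innovation:
  assumes "h \<in> innovation"
  shows "corr_form \<mu> h h = (\<integral>\<eta>. h \<eta> * h \<eta> \<partial>\<mu>)"
proof -
  have h: "h \<in> local_L2 \<mu>" and dep: "depends_on \<mu> (insert 0 lex_positive) h"
    and orth: "\<And>g. g \<in> L2 \<mu> \<Longrightarrow> depends_on \<mu> lex_positive g \<Longrightarrow> (\<integral>\<eta>. h \<eta> * g \<eta> \<partial>\<mu>) = 0"
    using assms unfolding innovation_def by blast+
  have h_meas: "h \<in> borel_measurable \<mu>" by (rule local_L2_measurable[OF h])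
  have mean: "(\<integral>\<eta>. h \<eta> \<partial>\<mu>) = 0"
    using orth[OF L2_const[of 1] depends_on_const] by simp
  have pos: "(\<integral>\<eta>. h \<eta> * translate x h \<eta> \<partial>\<mu>) = 0" if "x \<in> lex_positive" for x
  proof (rule orth)
    show "translate x h \<in> L2 \<mu>" by (rule translate_L2[OF local_L2D[OF h]])
    show "depends_on \<mu> lex_positive (translate x h)"
      by (rule depends_on_mono[OF depends_on_translate[OF dep]])
        (use that in \<open>auto intro: lex_positive_add\<close>)
  qed
  have zero: "corr_term \<mu> h h x = 0" if "x \<noteq> 0" for x
  proof -
    have "(\<integral>\<eta>. translate x h \<eta> * h \<eta> \<partial>\<mu>) = 0"
      using lex_positive_total[OF that]
    proof
      assume "x \<in> lex_positive" thus ?thesis using pos[of x] by (simp add: mult.commute)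
    next
      assume neg: "- x \<in> lex_positive"
      have "(\<integral>\<eta>. translate x h \<eta> * h \<eta> \<partial>\<mu>) =
          (\<integral>\<eta>. translate (- x) (\<lambda>\<eta>. translate x h \<eta> * h \<eta>) \<eta> \<partial>\<mu>)"
        by (rule integral_translate[symmetric])
          (intro borel_measurable_times measurable_translate h_meas)
      also have "\<dots> = (\<integral>\<eta>. h \<eta> * translate (- x) h \<eta> \<partial>\<mu>)"
        by (simp add: translate_def shift_shift)
      finally show ?thesis using pos[OF neg] by simp
    qed
    thus ?thesis by (simp add: corr_term_def mean)
  qed
  have "corr_form \<mu> h h = (\<Sum>\<^sub>\<infinity>x\<in>{0}. corr_term \<mu> h h x)"
    unfolding corr_form_def by (rule infsum_cong_neutral) (use zero in auto)
  thus ?thesis by (simp add: corr_term_def mean)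
qed

end

section \<open>Currents\<close>

context interacting_system
begin

sublocale field: shift_invariant_field \<mu> X
  by (intro shift_invariant_field.intro shift_invariant_field_axioms.intro prob_mu sets_mu
      translation_invariant_mu)

lemma site_obs_local_L2: "site_obs \<xi> x \<in> local_L2 \<mu>"
proof -
  have "depends_on \<mu> {0} (site_obs \<xi> 0)"
    unfolding depends_on_def
    by (intro bexI[of _ "site_obs \<xi> 0"]) (use xi_L2 in \<open>simp_all add: site_obs_def L2_def\<close>)
  hence "site_obs \<xi> 0 \<in> local_L2 \<mu>"
    by (rule field.local_L2I[OF xi_L2, rotated]) simp
  hence "translate x (site_obs \<xi> 0) \<in> local_L2 \<mu>"
    by (rule field.local_L2_translate)
  thus ?thesis by (simp add: translate_def site_obs_def shift_def)
qed

lemma L_local_L2: "f \<in> local_L2 \<mu> \<Longrightarrow> L x y f \<in> local_L2 \<mu>"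
  and L_lincomb: "f \<in> local_L2 \<mu> \<Longrightarrow> g \<in> local_L2 \<mu> \<Longrightarrow>
    ae_eq \<mu> (L x y (\<lambda>\<eta>. a * f \<eta> + b * g \<eta>)) (\<lambda>\<eta>. a * L x y f \<eta> + b * L x y g \<eta>)"
  using local_L[of x y] unfolding local_operator_def by blast+

lemma bond_current_local_L2: "bond_current L \<xi> x \<in> local_L2 \<mu>"
  unfolding bond_current_def by (intro field.local_L2_scale L_local_L2 site_obs_local_L2)

lemma current_local_L2: "current \<mu> L \<xi> \<alpha> \<in> local_L2 \<mu>"
  unfolding current_def by (intro field.local_L2_sum field.local_L2_scale bond_current_local_L2)

text \<open>By reversibility the mean of \<open>L\<^sub>0\<^sub>,\<^sub>x \<xi>\<^sub>0\<close> is \<open>\<langle>\<xi>\<^sub>0, L\<^sub>0\<^sub>,\<^sub>x 1\<rangle> = 0\<close>.\<close>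

lemma integral_bond_current: "(\<integral>\<eta>. bond_current L \<xi> x \<eta> \<partial>\<mu>) = 0"
proof -
  have "(\<integral>\<eta>. L 0 x (site_obs \<xi> 0) \<eta> \<partial>\<mu>) = (\<integral>\<eta>. site_obs \<xi> 0 \<eta> * L 0 x (\<lambda>_. 1) \<eta> \<partial>\<mu>)"
    using reversible[OF site_obs_local_L2[of 0] field.local_L2_const[of 1], of x] by simp
  also have "\<dots> = (\<integral>\<eta>. 0 \<partial>\<mu>)"
  proof (rule integral_cong_AE)
    show "(\<lambda>\<eta>. site_obs \<xi> 0 \<eta> * L 0 x (\<lambda>_. 1) \<eta>) \<in> borel_measurable \<mu>"
      by (intro borel_measurable_times field.local_L2_measurable[OF site_obs_local_L2]
          field.local_L2_measurable[OF L_local_L2[OF field.local_L2_const]])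
    show "ae_eq \<mu> (\<lambda>\<eta>. site_obs \<xi> 0 \<eta> * L 0 x (\<lambda>_. 1) \<eta>) (\<lambda>_. 0)"
      using L_one[of 0 x] by eventually_elim simp
  qed simp
  finally show ?thesis by (simp add: bond_current_def)
qed

lemma integral_current: "(\<integral>\<eta>. current \<mu> L \<xi> \<alpha> \<eta> \<partial>\<mu>) = 0"
proof -
  have int: "integrable \<mu> (bond_current L \<xi> x)" for x
    by (intro field.L2_integrable field.local_L2D bond_current_local_L2)
  show ?thesis unfolding current_def
    by (subst Bochner_Integration.integral_sum) (simp_all add: int integral_bond_current)
qed

text \<open>Symmetry and translation invariance turn \<open>L\<^sub>0\<^sub>,\<^sub>-\<^sub>z \<xi>\<^sub>0\<close> into the translate by \<open>- z\<close> of
  \<open>L\<^sub>0\<^sub>,\<^sub>z \<xi>\<^sub>z\<close>, and conservation on the bond gives \<open>L\<^sub>0\<^sub>,\<^sub>z \<xi>\<^sub>z = - L\<^sub>0\<^sub>,\<^sub>z \<xi>\<^sub>0\<close>: what flows out of one end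
  flows into the other.\<close>

lemma bond_current_uminus:
  "ae_eq \<mu> (bond_current L \<xi> (- z)) (\<lambda>\<eta>. - translate (- z) (bond_current L \<xi> z) \<eta>)"
proof -
  have shifted: "translate z (site_obs \<xi> 0) = site_obs \<xi> z"
    by (simp add: translate_def site_obs_def shift_def)
  have "AE \<eta> in \<mu>. L 0 z (site_obs \<xi> z) \<eta> = - L 0 z (site_obs \<xi> 0) \<eta>"
    using conserved_bond[of 0 z]
      L_lincomb[OF site_obs_local_L2[of 0] site_obs_local_L2[of z], of 0 z 1 1, unfolded mult_1]
    by eventually_elim simp
  hence "AE \<eta> in \<mu>. L 0 z (site_obs \<xi> z) (shift (- z) \<eta>) = - L 0 z (site_obs \<xi> 0) (shift (- z) \<eta>)"
    by (rule field.AE_translate)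
  moreover have "ae_eq \<mu> (L 0 (- z) (site_obs \<xi> 0)) (L (- z) 0 (site_obs \<xi> 0))"
    by (rule L_sym[OF site_obs_local_L2])
  moreover have "ae_eq \<mu> (L (- z) 0 (site_obs \<xi> 0)) (translate (- z) (L 0 z (site_obs \<xi> z)))"
    using translation_invariant_L[OF site_obs_local_L2[of 0], of "- z" 0] by (simp add: shifted)
  ultimately show ?thesis
    by eventually_elim (simp add: bond_current_def translate_def)
qed

lemma nearest_neighbour_current:
  assumes "nearest_neighbour \<mu> L"
  shows "ae_eq \<mu> (current \<mu> L \<xi> \<alpha>)
    (\<lambda>\<eta>. bond_current L \<xi> (unit_vec \<alpha>) \<eta> - bond_current L \<xi> (- unit_vec \<alpha>) \<eta>)"
proof -
  let ?j = "bond_current L \<xi>" and ?e = "unit_vec :: 'd \<Rightarrow> int ^ 'd"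
  let ?S = "{x. \<not> ae_eq \<mu> (?j x) (\<lambda>_. 0)}" and ?E = "{?e \<alpha>, - ?e \<alpha>}"
  have S: "?S \<subseteq> (\<Union>\<beta>. {?e \<beta>, - ?e \<beta>})"
  proof (rule ccontr)
    assume "\<not> ?S \<subseteq> (\<Union>\<beta>. {?e \<beta>, - ?e \<beta>})"
    then obtain x where x: "\<not> ae_eq \<mu> (?j x) (\<lambda>_. 0)" "x \<notin> (\<Union>\<beta>. {?e \<beta>, - ?e \<beta>})" by blast
    have "ae_eq \<mu> (L 0 x (site_obs \<xi> 0)) (\<lambda>_. 0)"
      using assms x(2) site_obs_local_L2 unfolding nearest_neighbour_def by blast
    hence "ae_eq \<mu> (?j x) (\<lambda>_. 0)" by eventually_elim (simp add: bond_current_def)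
    with x(1) show False by blast
  qed
  have fin: "finite ?S" by (rule finite_subset[OF S]) simp
  \<comment> \<open>The bonds in the other coordinate directions carry the weight \<open>x\<^sub>\<alpha> = 0\<close>.\<close>
  have comp: "x $ \<alpha> = 0" if "x \<in> ?S - ?E" for x
  proof -
    from that S obtain \<beta> where "x = ?e \<beta> \<or> x = - ?e \<beta>" by blast
    with that show ?thesis by (cases "\<beta> = \<alpha>") (auto simp: unit_vec_def axis_def)
  qed
  \<comment> \<open>The current omits a bond whose current vanishes almost everywhere; putting it back is harmless.\<close>
  have "AE \<eta> in \<mu>. \<forall>x\<in>?E - ?S. ?j x \<eta> = 0"
    by (rule AE_finite_allI) auto
  thus ?thesis
  proof eventually_elim
    case (elim \<eta>)
    have ne: "?e \<alpha> \<noteq> - ?e \<alpha>" by (simp add: unit_vec_def axis_def vec_eq_iff)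
    have "current \<mu> L \<xi> \<alpha> \<eta> = (\<Sum>x\<in>?S \<union> ?E. of_int (x $ \<alpha>) * ?j x \<eta>)"
      unfolding current_def by (rule sum.mono_neutral_left) (use fin elim in auto)
    also have "\<dots> = (\<Sum>x\<in>?E. of_int (x $ \<alpha>) * ?j x \<eta>)"
      by (rule sum.mono_neutral_right) (use fin comp in auto)
    also have "\<dots> = ?j (?e \<alpha>) \<eta> - ?j (- ?e \<alpha>) \<eta>"
      using ne by (simp add: unit_vec_def)
    finally show ?case .
  qed
qed

end

section \<open>The null space of the degenerate scalar product\<close>

context shift_invariant_field
begin

text \<open>A translate of \<open>f\<close> only reindexes the sum over all shifts.  This is why gradients are null vectors.\<close>

lemma corr_form_translate:
  assumes "f \<in> borel_measurable \<mu>"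
  shows "corr_form \<mu> (translate z f) g = corr_form \<mu> f g"
proof -
  have "corr_term \<mu> (translate z f) g = (\<lambda>x. corr_term \<mu> f g (x + z))"
    by (rule ext) (simp add: corr_term_def translate_translate integral_translate[OF assms])
  moreover have "bij (\<lambda>x. x + z)" by (rule bij_plus_right)
  ultimately show ?thesis
    unfolding corr_form_def using infsum_reindex_bij_betw[of "\<lambda>x. x + z" UNIV UNIV "corr_term \<mu> f g"]
    by simp
qed

lemma corr_form_cong_ae:
  assumes "f \<in> borel_measurable \<mu>" "f' \<in> borel_measurable \<mu>" "g \<in> borel_measurable \<mu>" "ae_eq \<mu> f f'"
  shows "corr_form \<mu> f g = corr_form \<mu> f' g"
proof -
  have "(\<integral>\<eta>. translate x f \<eta> * g \<eta> \<partial>\<mu>) = (\<integral>\<eta>. translate x f' \<eta> * g \<eta> \<partial>\<mu>)" for x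
    by (intro integral_cong_AE borel_measurable_times measurable_translate assms)
      (use ae_eq_translate[OF assms(4), of x] in \<open>eventually_elim; simp\<close>)
  moreover have "(\<integral>\<eta>. f \<eta> \<partial>\<mu>) = (\<integral>\<eta>. f' \<eta> \<partial>\<mu>)"
    by (intro integral_cong_AE assms)
  ultimately show ?thesis by (simp add: corr_form_def corr_term_def)
qed

end

context hilbert_system
begin

lemma iota_diff:
  assumes "f \<in> local_L2 \<mu>" "g \<in> local_L2 \<mu>"
  shows "\<iota> (\<lambda>\<eta>. f \<eta> - g \<eta>) = \<iota> f - \<iota> g"
  using iota_linear[OF assms, of 1 "-1"] by simp

lemma iota_scale: "f \<in> local_L2 \<mu> \<Longrightarrow> \<iota> (\<lambda>\<eta>. c * f \<eta>) = c *\<^sub>R \<iota> f"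
  using iota_linear[of f f c 0] by simp

lemma iota_zero: "\<iota> (\<lambda>_. 0) = 0"
  using iota_scale[OF field.local_L2_const[of 0], of 0] by simp

lemma iota_sum:
  assumes "\<And>i. i \<in> I \<Longrightarrow> f i \<in> local_L2 \<mu>"
  shows "\<iota> (\<lambda>\<eta>. \<Sum>i\<in>I. f i \<eta>) = (\<Sum>i\<in>I. \<iota> (f i))"
  using assms
proof (induction I rule: infinite_finite_induct)
  case (insert i I)
  have "(\<lambda>\<eta>. \<Sum>i\<in>I. f i \<eta>) \<in> local_L2 \<mu>"
    using insert.prems by (intro field.local_L2_sum) auto
  from iota_linear[OF _ this, of "f i" 1 1] show ?case using insert by simp
qed (simp_all add: iota_zero)

text \<open>The difference of \<open>f\<close> and \<open>g\<close> is itself a local function, so the hypothesis makes it orthogonal to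
  itself.\<close>

lemma iota_eqI:
  assumes "f \<in> local_L2 \<mu>" "g \<in> local_L2 \<mu>"
    and "\<And>k. k \<in> local_L2 \<mu> \<Longrightarrow> corr_form \<mu> f k = corr_form \<mu> g k"
  shows "\<iota> f = \<iota> g"
proof -
  have d: "(\<lambda>\<eta>. f \<eta> - g \<eta>) \<in> local_L2 \<mu>" using assms(1,2) by (rule field.local_L2_diff)
  have "\<iota> f \<bullet> \<iota> (\<lambda>\<eta>. f \<eta> - g \<eta>) = \<iota> g \<bullet> \<iota> (\<lambda>\<eta>. f \<eta> - g \<eta>)"
    using assms(3)[OF d] by (simp only: iota_inner[OF assms(1) d] iota_inner[OF assms(2) d])
  hence "(\<iota> f - \<iota> g) \<bullet> (\<iota> f - \<iota> g) = 0"
    by (simp only: iota_diff[OF assms(1,2)] inner_diff_left)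
  thus ?thesis by simp
qed

lemma iota_translate: "f \<in> local_L2 \<mu> \<Longrightarrow> \<iota> (translate z f) = \<iota> f"
  by (intro iota_eqI field.local_L2_translate field.corr_form_translate field.local_L2_measurable)

lemma iota_cong_ae:
  assumes "f \<in> local_L2 \<mu>" "g \<in> local_L2 \<mu>" "ae_eq \<mu> f g"
  shows "\<iota> f = \<iota> g"
  by (intro iota_eqI field.corr_form_cong_ae field.local_L2_measurable assms)

lemma iota_gradient:
  assumes "f \<in> local_L2 \<mu>" "f \<in> gradient_space \<mu>"
  shows "\<iota> f = 0"
proof -
  obtain g where g: "\<And>\<alpha>. g \<alpha> \<in> local_L2 \<mu>"
    "ae_eq \<mu> f (\<lambda>\<eta>. \<Sum>\<alpha>\<in>UNIV. translate (unit_vec \<alpha>) (g \<alpha>) \<eta> - g \<alpha> \<eta>)"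
    using assms(2) unfolding gradient_space_def by blast
  have diff: "(\<lambda>\<eta>. translate (unit_vec \<alpha>) (g \<alpha>) \<eta> - g \<alpha> \<eta>) \<in> local_L2 \<mu>" for \<alpha>
    by (intro field.local_L2_diff field.local_L2_translate g(1))
  have "\<iota> f = \<iota> (\<lambda>\<eta>. \<Sum>\<alpha>\<in>UNIV. translate (unit_vec \<alpha>) (g \<alpha>) \<eta> - g \<alpha> \<eta>)"
    by (intro iota_cong_ae assms(1) field.local_L2_sum diff g(2))
  also have "\<dots> = (\<Sum>\<alpha>\<in>UNIV. \<iota> (\<lambda>\<eta>. translate (unit_vec \<alpha>) (g \<alpha>) \<eta> - g \<alpha> \<eta>))"
    by (rule iota_sum[OF diff])
  also have "\<dots> = 0"
    by (rule sum.neutral) (simp add: iota_diff g(1) field.local_L2_translate iota_translate)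
  finally show ?thesis .
qed

text \<open>If \<open>f\<close> is null, so is the innovation \<open>h\<close> that it equals modulo gradients.  But the scalar product
  of \<open>h\<close> with itself is its squared \<open>L\<^sup>2\<close> norm, so \<open>h\<close> vanishes almost everywhere.\<close>

lemma iota_eq_zero_iff_gradient:
  assumes field: "product_field \<mu> \<nu>" and f: "f \<in> local_L2 \<mu>" and mean: "(\<integral>\<eta>. f \<eta> \<partial>\<mu>) = 0"
  shows "\<iota> f = 0 \<longleftrightarrow> f \<in> gradient_space \<mu>"
proof
  interpret product_field \<mu> \<nu> by (rule field)
  assume null: "\<iota> f = 0"
  obtain h where h: "h \<in> innovation" "(\<lambda>\<eta>. f \<eta> - (\<integral>\<zeta>. f \<zeta> \<partial>\<mu>) - h \<eta>) \<in> gradient_space \<mu>"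
    by (rule ex_innovation[OF f])
  have h_local: "h \<in> local_L2 \<mu>" using h(1) unfolding innovation_def by blast
  have fh: "(\<lambda>\<eta>. f \<eta> - h \<eta>) \<in> gradient_space \<mu>" using h(2) by (simp add: mean)
  have "\<iota> f - \<iota> h = 0"
    using iota_gradient[OF local_L2_diff[OF f h_local] fh] by (simp add: iota_diff f h_local)
  hence "\<iota> h \<bullet> \<iota> h = 0" using null by simp
  hence "(\<integral>\<eta>. h \<eta> * h \<eta> \<partial>\<mu>) = 0"
    by (simp only: iota_inner[OF h_local h_local] corr_form_innovation[OF h(1)])
  hence "ae_eq \<mu> h (\<lambda>_. 0)" by (rule ae_zero_of_square_integral[OF local_L2D[OF h_local]])
  hence "ae_eq \<mu> (\<lambda>\<eta>. f \<eta> - h \<eta>) f" by eventually_elim simp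
  thus "f \<in> gradient_space \<mu>" by (rule gradient_space_cong_ae[OF fh])
qed (rule iota_gradient[OF f])

lemma iota_nearest_neighbour_current:
  assumes "nearest_neighbour \<mu> L"
  shows "\<iota> (current \<mu> L \<xi> \<alpha>) = 2 *\<^sub>R \<iota> (bond_current L \<xi> (unit_vec \<alpha>))"
proof -
  let ?j = "bond_current L \<xi> (unit_vec \<alpha>)"
  note j = bond_current_local_L2[of "unit_vec \<alpha>"]
  note tj = field.local_L2_translate[OF j, of "- unit_vec \<alpha>"]
  have "ae_eq \<mu> (current \<mu> L \<xi> \<alpha>) (\<lambda>\<eta>. 1 * ?j \<eta> + 1 * translate (- unit_vec \<alpha>) ?j \<eta>)"
    using nearest_neighbour_current[OF assms, of \<alpha>] bond_current_uminus[of "unit_vec \<alpha>"]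
    by eventually_elim simp
  hence "\<iota> (current \<mu> L \<xi> \<alpha>) = \<iota> (\<lambda>\<eta>. 1 * ?j \<eta> + 1 * translate (- unit_vec \<alpha>) ?j \<eta>)"
    by (intro iota_cong_ae current_local_L2 field.local_L2_lincomb j tj)
  also have "\<dots> = 2 *\<^sub>R \<iota> ?j"
    by (simp only: iota_linear[OF j tj] iota_translate[OF j]) (simp add: scaleR_2)
  finally show ?thesis .
qed

end

section \<open>The variational formula\<close>

lemma generator_of_eqI:
  assumes "generates T u v"
  shows "generator_of T u = v"
  unfolding generator_of_def using assms
  by (intro the_equality) (auto simp: generates_def intro: tendsto_unique[OF trivial_limit_at_right_real])

text \<open>For small \<open>c\<close> the linear term dominates the quadratic one; for \<open>b \<noteq> 0\<close> the minimiser
  \<open>c = a / (2 b)\<close> of \<open>c\<^sup>2 b - c a\<close> already gives the contradiction.\<close>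

lemma linear_below_quadratic_imp_zero:
  fixes a b :: real
  assumes "\<And>c. c * a \<le> c\<^sup>2 * b" "b \<ge> 0"
  shows "a = 0"
proof (cases "b = 0")
  case True
  with assms(1)[of a] show ?thesis by (auto simp: mult_le_0_iff)
next
  case False
  hence "b > 0" using assms(2) by simp
  have "a / (2 * b) * a \<le> (a / (2 * b))\<^sup>2 * b" by (rule assms(1))
  hence "a\<^sup>2 / (2 * b) \<le> a\<^sup>2 / (4 * b)"
    using \<open>b > 0\<close> by (simp add: power2_eq_square field_simps)
  hence "a\<^sup>2 \<le> 0" using \<open>b > 0\<close> by (simp add: field_simps)
  thus ?thesis by simp
qed

text \<open>Polarisation.  The variational formula determines only the quadratic form of \<open>D\<close>; symmetry recovers
  the matrix from it.\<close>

lemma symmetric_matrix_eqI: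
  fixes A B :: "real ^ 'd ^ 'd"
  assumes symA: "\<And>\<alpha> \<beta>. A $ \<alpha> $ \<beta> = A $ \<beta> $ \<alpha>" and symB: "\<And>\<alpha> \<beta>. B $ \<alpha> $ \<beta> = B $ \<beta> $ \<alpha>"
    and form: "\<And>l :: real ^ 'd. (\<Sum>\<alpha>\<in>UNIV. \<Sum>\<beta>\<in>UNIV. l $ \<alpha> * l $ \<beta> * A $ \<alpha> $ \<beta>) =
      (\<Sum>\<alpha>\<in>UNIV. \<Sum>\<beta>\<in>UNIV. l $ \<alpha> * l $ \<beta> * B $ \<alpha> $ \<beta>)"
  shows "A = B"
proof -
  have bilinear: "l \<bullet> (C *v l) = (\<Sum>\<alpha>\<in>UNIV. \<Sum>\<beta>\<in>UNIV. l $ \<alpha> * l $ \<beta> * C $ \<alpha> $ \<beta>)"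
    for l and C :: "real ^ 'd ^ 'd"
    by (simp add: inner_vec_def matrix_vector_mult_def sum_distrib_left mult_ac)
  have entry: "axis \<alpha> 1 \<bullet> (C *v axis \<beta> 1) = C $ \<alpha> $ \<beta>" for \<alpha> \<beta> and C :: "real ^ 'd ^ 'd"
    by (simp add: inner_axis' matrix_vector_mult_basis column_def)
  have diag: "l \<bullet> (A *v l) = l \<bullet> (B *v l)" for l unfolding bilinear by (rule form)
  have "A $ \<alpha> $ \<beta> = B $ \<alpha> $ \<beta>" for \<alpha> \<beta>
    using diag[of "axis \<alpha> 1 + axis \<beta> 1"] diag[of "axis \<alpha> 1"] diag[of "axis \<beta> 1"] symA[of \<alpha> \<beta>] symB[of \<alpha> \<beta>]
    unfolding matrix_vector_right_distrib inner_add_left inner_add_right entry by linarith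
  thus ?thesis by (simp add: vec_eq_iff)
qed

context hilbert_system
begin

lemma generator_scale:
  assumes "u \<in> generator_domain T"
  shows "generator_of T (c *\<^sub>R u) = c *\<^sub>R generator_of T u"
proof -
  obtain v where v: "generates T u v" using assms by (auto simp: generator_domain_def)
  have "((\<lambda>t. c *\<^sub>R ((T t u - u) /\<^sub>R t)) \<longlongrightarrow> c *\<^sub>R v) (at_right 0)"
    using v unfolding generates_def by (intro tendsto_scaleR tendsto_const)
  moreover have "\<forall>\<^sub>F t in at_right 0. c *\<^sub>R ((T t u - u) /\<^sub>R t) = (T t (c *\<^sub>R u) - c *\<^sub>R u) /\<^sub>R t"
    using eventually_at_right_less[of 0]
  proof eventually_elim
    case (elim t)
    then interpret bounded_linear "T t" by (intro T_bounded_linear) simp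
    show ?case by (simp add: scaleR scaleR_diff_right mult.commute)
  qed
  ultimately have "generates T (c *\<^sub>R u) (c *\<^sub>R v)"
    unfolding generates_def by (rule Lim_transform_eventually)
  with v show ?thesis by (simp add: generator_of_eqI)
qed

lemma variational_functional_eq:
  assumes "f \<in> local_L2 \<mu>"
  shows "variational_functional \<mu> L \<xi> \<iota> T l f =
    - ((\<Sum>\<alpha>\<in>UNIV. l $ \<alpha> *\<^sub>R \<iota> (current \<mu> L \<xi> \<alpha>)) \<bullet> \<iota> f) - \<iota> f \<bullet> generator_of T (\<iota> f)"
proof -
  have lj: "(\<lambda>\<eta>. l $ \<alpha> * current \<mu> L \<xi> \<alpha> \<eta>) \<in> local_L2 \<mu>" for \<alpha>
    by (intro field.local_L2_scale current_local_L2)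
  show ?thesis
    unfolding variational_functional_def
    by (simp add: iota_inner[OF field.local_L2_sum[OF lj] assms, symmetric] iota_sum[OF lj]
        iota_scale[OF current_local_L2])
qed

end

context diffusive_system
begin

text \<open>If the matrices agree, the infimum vanishes, so the functional is nonnegative; along the multiples of
  \<open>f = j\<^sub>\<alpha>\<close> its linear part is the squared norm of \<open>j\<^sub>\<alpha>\<close>, which must therefore be zero.  Conversely, without
  the linear part the functional is the nonnegative form of the generator, whose minimum is attained at
  \<open>0\<close>.\<close>

lemma diffusion_matrix_eq_static_iff:
  "diffusion_matrix \<mu> \<xi> W Y = static_diffusion_matrix \<mu> L \<xi> W Y \<longleftrightarrow>
    (\<forall>\<alpha>. \<iota> (current \<mu> L \<xi> \<alpha>) = 0)"
proof
  assume eq: "diffusion_matrix \<mu> \<xi> W Y = static_diffusion_matrix \<mu> L \<xi> W Y"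
  show "\<forall>\<alpha>. \<iota> (current \<mu> L \<xi> \<alpha>) = 0"
  proof
    fix \<alpha>
    let ?l = "axis \<alpha> 1 :: real ^ 'd" and ?f = "current \<mu> L \<xi> \<alpha>"
    let ?V = "variational_functional \<mu> L \<xi> \<iota> T ?l"
    have "(INF f\<in>local_L2 \<mu>. ?V f) = 0"
      using variational_formula[of ?l] compressibility_pos unfolding eq by simp
    hence V: "?V f \<ge> 0" if "f \<in> local_L2 \<mu>" for f
      using cINF_lower[OF variational_bdd_below[of ?l] that] by simp
    have combination: "(\<Sum>\<beta>\<in>UNIV. ?l $ \<beta> *\<^sub>R \<iota> (current \<mu> L \<xi> \<beta>)) = \<iota> ?f"
    proof -
      have "(\<Sum>\<beta>\<in>UNIV. ?l $ \<beta> *\<^sub>R \<iota> (current \<mu> L \<xi> \<beta>)) = (\<Sum>\<beta>\<in>UNIV. if \<beta> = \<alpha> then \<iota> ?f else 0)"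
        by (intro sum.cong) (auto simp: axis_def)
      thus ?thesis by simp
    qed
    note f = current_local_L2[of \<alpha>]
    have "\<iota> ?f \<bullet> \<iota> ?f = 0"
    proof (rule linear_below_quadratic_imp_zero)
      show "0 \<le> - (\<iota> ?f \<bullet> generator_of T (\<iota> ?f))" by (rule generator_nonpos[OF f])
      show "c * (\<iota> ?f \<bullet> \<iota> ?f) \<le> c\<^sup>2 * - (\<iota> ?f \<bullet> generator_of T (\<iota> ?f))" for c
        using V[OF field.local_L2_scale[OF f, of c]]
        by (simp add: variational_functional_eq[OF field.local_L2_scale[OF f]] combination
            iota_scale[OF f] generator_scale[OF local_in_domain[OF f]] power2_eq_square)
    qed
    thus "\<iota> ?f = 0" by simp
  qed
next
  assume null: "\<forall>\<alpha>. \<iota> (current \<mu> L \<xi> \<alpha>) = 0"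
  show "diffusion_matrix \<mu> \<xi> W Y = static_diffusion_matrix \<mu> L \<xi> W Y"
  proof (rule symmetric_matrix_eqI)
    show "diffusion_matrix \<mu> \<xi> W Y $ \<alpha> $ \<beta> = diffusion_matrix \<mu> \<xi> W Y $ \<beta> $ \<alpha>" for \<alpha> \<beta>
      unfolding diffusion_matrix_def scaled_variance_def by (simp add: mult_ac)
    show "static_diffusion_matrix \<mu> L \<xi> W Y $ \<alpha> $ \<beta> = static_diffusion_matrix \<mu> L \<xi> W Y $ \<beta> $ \<alpha>" for \<alpha> \<beta>
      unfolding static_diffusion_matrix_def by (simp add: mult_ac)
    fix l :: "real ^ 'd"
    let ?V = "variational_functional \<mu> L \<xi> \<iota> T l"
    have V: "?V f = - (\<iota> f \<bullet> generator_of T (\<iota> f))" if "f \<in> local_L2 \<mu>" for f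
      using null by (simp add: variational_functional_eq[OF that])
    have "(INF f\<in>local_L2 \<mu>. ?V f) = 0"
    proof (rule cInf_eq_minimum)
      have "?V (\<lambda>_. 0) = 0" using V[OF field.local_L2_const] by (simp add: iota_zero)
      thus "0 \<in> ?V ` local_L2 \<mu>" using field.local_L2_const by (metis imageI)
      show "0 \<le> v" if "v \<in> ?V ` local_L2 \<mu>" for v
        using that V generator_nonpos by auto
    qed
    thus "(\<Sum>\<alpha>\<in>UNIV. \<Sum>\<beta>\<in>UNIV. l $ \<alpha> * l $ \<beta> * diffusion_matrix \<mu> \<xi> W Y $ \<alpha> $ \<beta>) =
      (\<Sum>\<alpha>\<in>UNIV. \<Sum>\<beta>\<in>UNIV. l $ \<alpha> * l $ \<beta> * static_diffusion_matrix \<mu> L \<xi> W Y $ \<alpha> $ \<beta>)"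
      using variational_formula[of l] by simp
  qed
qed

end

section \<open>Gradient systems are those with static diffusion matrix\<close>

theorem corollary2p1:
  fixes X \<nu> :: "'a measure"
    and \<mu> :: "('a, 'd::finite) config measure"
    and L :: "('a, 'd) interaction"
    and \<xi> :: "'a \<Rightarrow> real"
    and W :: "'w measure"
    and Y :: "real \<Rightarrow> 'w \<Rightarrow> ('a, 'd) config"
    and P :: "real \<Rightarrow> ('a, 'd) obs \<Rightarrow> ('a, 'd) obs"
    and \<iota> :: "('a, 'd) obs \<Rightarrow> 'h::{real_inner, banach}"
    and T :: "real \<Rightarrow> 'h \<Rightarrow> 'h"
  assumes "diffusive_system X \<mu> L \<xi> W Y P \<iota> T"
    and "prob_space \<nu>" and "sets \<nu> = sets X"
    and "\<mu> = Pi\<^sub>M UNIV (\<lambda>_. \<nu>)"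
    and "L2_separable \<nu>"
  shows "(gradient_condition \<mu> L \<xi> \<longleftrightarrow>
            diffusion_matrix \<mu> \<xi> W Y = static_diffusion_matrix \<mu> L \<xi> W Y) \<and>
         (nearest_neighbour \<mu> L \<longrightarrow>
            (diffusion_matrix \<mu> \<xi> W Y = static_diffusion_matrix \<mu> L \<xi> W Y \<longleftrightarrow>
             (\<forall>\<alpha>. bond_current L \<xi> (unit_vec \<alpha>) \<in> gradient_space \<mu>)))"
proof -
  interpret diffusive_system X \<mu> L \<xi> W Y P \<iota> T by fact
  have product: "product_field \<mu> \<nu>"
    by (intro product_field.intro product_field_axioms.intro shift_invariant_field.intro
        shift_invariant_field_axioms.intro assms(2,4) prob_mu translation_invariant_mu)
      (simp add: assms(4))
  have current: "\<iota> (current \<mu> L \<xi> \<alpha>) = 0 \<longleftrightarrow> current \<mu> L \<xi> \<alpha> \<in> gradient_space \<mu>" for \<alpha>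
    by (rule iota_eq_zero_iff_gradient[OF product current_local_L2 integral_current])
  have bond: "\<iota> (bond_current L \<xi> x) = 0 \<longleftrightarrow> bond_current L \<xi> x \<in> gradient_space \<mu>" for x
    by (rule iota_eq_zero_iff_gradient[OF product bond_current_local_L2 integral_bond_current])
  show ?thesis
  proof (intro conjI impI)
    show "gradient_condition \<mu> L \<xi> \<longleftrightarrow>
        diffusion_matrix \<mu> \<xi> W Y = static_diffusion_matrix \<mu> L \<xi> W Y"
      unfolding gradient_condition_def diffusion_matrix_eq_static_iff current ..
    assume "nearest_neighbour \<mu> L"
    thus "diffusion_matrix \<mu> \<xi> W Y = static_diffusion_matrix \<mu> L \<xi> W Y \<longleftrightarrow>
        (\<forall>\<alpha>. bond_current L \<xi> (unit_vec \<alpha>) \<in> gradient_space \<mu>)"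
      unfolding diffusion_matrix_eq_static_iff
      by (simp add: iota_nearest_neighbour_current bond)
  qed
qed

end
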